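(* Let $T$ be a regular positive initial tree which is modest, i.e. $T$ is neither signalling, nor generalized Henkin, nor coordinated. Then $T$ is in FO; that is, for every weak sentential completing function $e$ for $T$, the class of finite models of the sentence $\hat e(T)$ is definable by a first-order sentence.
   Context: IF logic: formulas are built from atomic formulas and negated atomic formulas by $\land$, $\lor$ and slashed quantifiers $(\exists v/V)$, $(\forall v/V)$, with $V$ a finite set of variables ($\exists v$, $\forall v$ denote slash set $\emptyset$). Free variables are as in first-order logic except $FV((Qv/V)\chi)=(FV(\chi)\setminus\{v\})\cup V$. Team semantics: a team $X$ on $M$ is a set of assignments with a common finite domain; $X[M/v]=\{s(a/v): s\in X, a\in M\}$; for $F:X\to M$, $X[F/v]=\{s(F(s)/v):s\in X\}$; $F$ is $V$-uniform if $F(s)=F(s')$ whenever $s,s'$ agree outside $V$. $M,X\models\psi$ for quantifier-free $\psi$ iff every $s\in X$ satisfies $\psi$ classically; $\psi\land\chi$: both; $\psi\lor\chi$: $X=Y\cup Z$ with $M,Y\models\psi$, $M,Z\models\chi$; $(\forall v/V)\psi$: $M,X[M/v]\models\psi$; $(\exists v/V)\psi$: $M,X[F/v]\models\psi$ for some $V$-uniform $F:X\to M$. A sentence $\varphi$ is true in $M$ iff $M,\{\emptyset\}\models\varphi$. Trees: a synctactical tree is a finite tree (root minimal, order $\prec$ = "is in the scope of" reversed: $A\prec B$ means $B$ lies below $A$) whose nodes are occurrences of atomic formulas (leaves), negations and quantifiers $(Qv/V)$ (at most one successor each) and $\land,\lor$ (at most two successors). A positive initial tree contains no atomic formulas and no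 negations. $\hat T$ is obtained by attaching new "gap" leaves: to each connective, $2$ minus its number of successors; to each quantifier without successor, one. A path of $T$ is a maximal linearly ordered subset of $\hat T$; $Path(T)$ is the set of paths. $Bound(R)$ is the set of variables quantified in $R$. $T$ is regular if no variable occurs both free and bound in $T$ and no quantifier $(Qv/V)$ lies in the scope of a quantifier $(Qv/W)$ of the same kind on the same variable. A completing function for $T$ is a map $e$ from $Path(T)$ to regular IF formulas; it is weak if all its values are quantifier-free, sentential if $FV(e(P))\subseteq Bound(P)$ for every path $P$. $\hat e(T)$ is the formula obtained by placing $e(P)$ at the gap ending each path $P$. $T$ is in a complexity class $K$ if for every weak sentential completing function $e$ the class of finite models of $\hat e(T)$ is in $K$. Dependence: a quantifier occurrence $(Qy/Y)$ depends on $(Q'x/X)$ (on $x$) if $(Qy/Y)$ lies in the scope of $(Q'x/X)$ and $x\notin Y$; otherwise it does not depend on it. A connective or quantifier "depends on" / lies in the scope of an operator that is above it. A path is signalling if it contains $(\forall x/X),(\exists y/Y),(\exists z/Z)$ with $(\exists y/Y)$ depending on $(\forall x/X)$, and $(\exists z/Z)$ depending on $(\exists y/Y)$ but not on $(\forall x/X)$; a tree is signalling if some path is. A tree is generalized Henkin if it contains $\forall x,\forall y,(\exists u/U),(\exists v/V)$ such that both existentials lie in the scope of $\forall x$, $u$ depends on $x$ but not on $y$ nor $v$, and $v$ depends on $y$ but not on $x$ nor $u$. A tree is coordinated if it contains $(\forall x/X)$, $\lor$, $(\forall y/Y)$, $(\forall z/Z)$, $(\exists u/U)$, $(\exists w/W)$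 such that: $\lor$ lies in the scope of $\forall x$; $(\exists u/U)$ and $(\exists w/W)$ lie in the scope of $\lor$; $(\exists u/U)$ depends on $y$ but not on $x,z,w$; $(\exists w/W)$ depends on $z$ but not on $x,y,u$.
   Formalization: Regular is read as: no quantifier on v lies in the scope of any quantifier on v, of either kind; in generalized Henkin trees the universal quantifiers ∀x, ∀y may carry arbitrary slash sets. With the literal readings the claim is false. *)

theory Defs
  imports Main "HOL-Library.FSet" "HOL-Library.Sublist"
begin

section \<open>Atomic formulas and structures\<close>

text \<open>
  The type parameters \<open>'f\<close> and \<open>'r\<close> supply function and relation symbols; a symbol carries
  the number of its arguments with it, so \<open>R\<close> used with two different numbers of arguments counts
  as two different symbols. Constants are function symbols with no arguments.
\<close>

type_synonym var = nat

datatype 'f trm = Var var | Fun 'f "'f trm list"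

datatype ('f, 'r) atom = Equal "'f trm" "'f trm" | Rel 'r "'f trm list"

datatype ('f, 'r) symbol = FunSym 'f nat | RelSym 'r nat

fun trm_vars :: "'f trm \<Rightarrow> var set" where
  "trm_vars (Var x) = {x}"
| "trm_vars (Fun f ts) = (\<Union>t\<in>set ts. trm_vars t)"

fun trm_syms :: "'f trm \<Rightarrow> ('f, 'r) symbol set" where
  "trm_syms (Var x) = {}"
| "trm_syms (Fun f ts) = insert (FunSym f (length ts)) (\<Union>t\<in>set ts. trm_syms t)"

fun atom_vars :: "('f, 'r) atom \<Rightarrow> var set" where
  "atom_vars (Equal t u) = trm_vars t \<union> trm_vars u"
| "atom_vars (Rel r ts) = (\<Union>t\<in>set ts. trm_vars t)"

fun atom_syms :: "('f, 'r) atom \<Rightarrow> ('f, 'r) symbol set" where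
  "atom_syms (Equal t u) = trm_syms t \<union> trm_syms u"
| "atom_syms (Rel r ts) = insert (RelSym r (length ts)) (\<Union>t\<in>set ts. trm_syms t)"

record ('a, 'f, 'r) struct =
  univ :: "'a set"
  fint :: "'f \<Rightarrow> 'a list \<Rightarrow> 'a"
  rint :: "'r \<Rightarrow> 'a list \<Rightarrow> bool"

definition finite_structure :: "('a, 'f, 'r) struct \<Rightarrow> bool" where
  "finite_structure M \<longleftrightarrow> finite (univ M) \<and> univ M \<noteq> {} \<and>
     (\<forall>f as. set as \<subseteq> univ M \<longrightarrow> fint M f as \<in> univ M)"

text \<open>An assignment is a partial map, whose domain is the set of variables it assigns.\<close>

type_synonym 'a assignment = "var \<rightharpoonup> 'a"

fun trm_val :: "('a, 'f, 'r) struct \<Rightarrow> 'a assignment \<Rightarrow> 'f trm \<Rightarrow> 'a" where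
  "trm_val M s (Var x) = the (s x)"
| "trm_val M s (Fun f ts) = fint M f (map (trm_val M s) ts)"

fun atom_holds :: "('a, 'f, 'r) struct \<Rightarrow> 'a assignment \<Rightarrow> ('f, 'r) atom \<Rightarrow> bool" where
  "atom_holds M s (Equal t u) \<longleftrightarrow> trm_val M s t = trm_val M s u"
| "atom_holds M s (Rel r ts) \<longleftrightarrow> rint M r (map (trm_val M s) ts)"


section \<open>First-order logic\<close>

datatype ('f, 'r) fo =
    FAtom "('f, 'r) atom"
  | FNot "('f, 'r) fo"
  | FAnd "('f, 'r) fo" "('f, 'r) fo"
  | FOr "('f, 'r) fo" "('f, 'r) fo"
  | FEx var "('f, 'r) fo"
  | FAll var "('f, 'r) fo"

fun fo_FV :: "('f, 'r) fo \<Rightarrow> var set" where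
  "fo_FV (FAtom a) = atom_vars a"
| "fo_FV (FNot \<phi>) = fo_FV \<phi>"
| "fo_FV (FAnd \<phi> \<psi>) = fo_FV \<phi> \<union> fo_FV \<psi>"
| "fo_FV (FOr \<phi> \<psi>) = fo_FV \<phi> \<union> fo_FV \<psi>"
| "fo_FV (FEx v \<phi>) = fo_FV \<phi> - {v}"
| "fo_FV (FAll v \<phi>) = fo_FV \<phi> - {v}"

fun fo_syms :: "('f, 'r) fo \<Rightarrow> ('f, 'r) symbol set" where
  "fo_syms (FAtom a) = atom_syms a"
| "fo_syms (FNot \<phi>) = fo_syms \<phi>"
| "fo_syms (FAnd \<phi> \<psi>) = fo_syms \<phi> \<union> fo_syms \<psi>"
| "fo_syms (FOr \<phi> \<psi>) = fo_syms \<phi> \<union> fo_syms \<psi>"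
| "fo_syms (FEx v \<phi>) = fo_syms \<phi>"
| "fo_syms (FAll v \<phi>) = fo_syms \<phi>"

fun fo_sat :: "('a, 'f, 'r) struct \<Rightarrow> 'a assignment \<Rightarrow> ('f, 'r) fo \<Rightarrow> bool" where
  "fo_sat M s (FAtom a) \<longleftrightarrow> atom_holds M s a"
| "fo_sat M s (FNot \<phi>) \<longleftrightarrow> \<not> fo_sat M s \<phi>"
| "fo_sat M s (FAnd \<phi> \<psi>) \<longleftrightarrow> fo_sat M s \<phi> \<and> fo_sat M s \<psi>"
| "fo_sat M s (FOr \<phi> \<psi>) \<longleftrightarrow> fo_sat M s \<phi> \<or> fo_sat M s \<psi>"
| "fo_sat M s (FEx v \<phi>) \<longleftrightarrow> (\<exists>a\<in>univ M. fo_sat M (s(v \<mapsto> a)) \<phi>)"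
| "fo_sat M s (FAll v \<phi>) \<longleftrightarrow> (\<forall>a\<in>univ M. fo_sat M (s(v \<mapsto> a)) \<phi>)"

definition fo_sentence :: "('f, 'r) fo \<Rightarrow> bool" where
  "fo_sentence \<theta> \<longleftrightarrow> fo_FV \<theta> = {}"

definition fo_true :: "('a, 'f, 'r) struct \<Rightarrow> ('f, 'r) fo \<Rightarrow> bool" where
  "fo_true M \<theta> \<longleftrightarrow> fo_sat M Map.empty \<theta>"


section \<open>IF logic\<close>

datatype conn = Conj | Disj

datatype quant = Forall | Exists

datatype ('f, 'r) ifml =
    Pos "('f, 'r) atom"
  | Neg "('f, 'r) atom"
  | Conn conn "('f, 'r) ifml" "('f, 'r) ifml"
  | Quant quant var "var fset" "('f, 'r) ifml"

fun FV :: "('f, 'r) ifml \<Rightarrow> var set" where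
  "FV (Pos a) = atom_vars a"
| "FV (Neg a) = atom_vars a"
| "FV (Conn c \<phi> \<psi>) = FV \<phi> \<union> FV \<psi>"
| "FV (Quant Q v V \<chi>) = (FV \<chi> - {v}) \<union> fset V"

fun Bound :: "('f, 'r) ifml \<Rightarrow> var set" where
  "Bound (Pos a) = {}"
| "Bound (Neg a) = {}"
| "Bound (Conn c \<phi> \<psi>) = Bound \<phi> \<union> Bound \<psi>"
| "Bound (Quant Q v V \<chi>) = insert v (Bound \<chi>)"

fun syms :: "('f, 'r) ifml \<Rightarrow> ('f, 'r) symbol set" where
  "syms (Pos a) = atom_syms a"
| "syms (Neg a) = atom_syms a"
| "syms (Conn c \<phi> \<psi>) = syms \<phi> \<union> syms \<psi>"
| "syms (Quant Q v V \<chi>) = syms \<chi>"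

fun quantifier_free :: "('f, 'r) ifml \<Rightarrow> bool" where
  "quantifier_free (Pos a) \<longleftrightarrow> True"
| "quantifier_free (Neg a) \<longleftrightarrow> True"
| "quantifier_free (Conn c \<phi> \<psi>) \<longleftrightarrow> quantifier_free \<phi> \<and> quantifier_free \<psi>"
| "quantifier_free (Quant Q v V \<chi>) \<longleftrightarrow> False"

text \<open>No quantifier on \<open>v\<close> in the scope of another quantifier on \<open>v\<close>, be it universal or existential.\<close>

fun no_requantification :: "('f, 'r) ifml \<Rightarrow> bool" where
  "no_requantification (Pos a) \<longleftrightarrow> True"
| "no_requantification (Neg a) \<longleftrightarrow> True"
| "no_requantification (Conn c \<phi> \<psi>) \<longleftrightarrow> no_requantification \<phi> \<and> no_requantification \<psi>"
| "no_requantification (Quant Q v V \<chi>) \<longleftrightarrow> v \<notin> Bound \<chi> \<and> no_requantification \<chi>"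

definition regular :: "('f, 'r) ifml \<Rightarrow> bool" where
  "regular \<phi> \<longleftrightarrow> FV \<phi> \<inter> Bound \<phi> = {} \<and> no_requantification \<phi>"


subsection \<open>Team semantics\<close>

definition duplicate_team :: "'a assignment set \<Rightarrow> 'a set \<Rightarrow> var \<Rightarrow> 'a assignment set" where
  "duplicate_team X A v = {s(v \<mapsto> a) | s a. s \<in> X \<and> a \<in> A}"

definition supplement_team ::
    "'a assignment set \<Rightarrow> ('a assignment \<Rightarrow> 'a) \<Rightarrow> var \<Rightarrow> 'a assignment set" where
  "supplement_team X F v = {s(v \<mapsto> F s) | s. s \<in> X}"

definition uniform_on :: "var set \<Rightarrow> 'a assignment set \<Rightarrow> ('a assignment \<Rightarrow> 'b) \<Rightarrow> bool" where
  "uniform_on V X F \<longleftrightarrow>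
     (\<forall>s\<in>X. \<forall>s'\<in>X. (\<forall>w. w \<notin> V \<longrightarrow> s w = s' w) \<longrightarrow> F s = F s')"

fun team_sat :: "('a, 'f, 'r) struct \<Rightarrow> 'a assignment set \<Rightarrow> ('f, 'r) ifml \<Rightarrow> bool" where
  "team_sat M X (Pos a) \<longleftrightarrow> (\<forall>s\<in>X. atom_holds M s a)"
| "team_sat M X (Neg a) \<longleftrightarrow> (\<forall>s\<in>X. \<not> atom_holds M s a)"
| "team_sat M X (Conn Conj \<psi> \<chi>) \<longleftrightarrow> team_sat M X \<psi> \<and> team_sat M X \<chi>"
| "team_sat M X (Conn Disj \<psi> \<chi>) \<longleftrightarrow> (\<exists>Y Z. X = Y \<union> Z \<and> team_sat M Y \<psi> \<and> team_sat M Z \<chi>)"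
| "team_sat M X (Quant Forall v V \<psi>) \<longleftrightarrow> team_sat M (duplicate_team X (univ M) v) \<psi>"
| "team_sat M X (Quant Exists v V \<psi>) \<longleftrightarrow>
     (\<exists>F. (\<forall>s\<in>X. F s \<in> univ M) \<and> uniform_on (fset V) X F \<and> team_sat M (supplement_team X F v) \<psi>)"

definition if_true :: "('a, 'f, 'r) struct \<Rightarrow> ('f, 'r) ifml \<Rightarrow> bool" where
  "if_true M \<phi> \<longleftrightarrow> team_sat M {Map.empty} \<phi>"

text \<open>On quantifier-free formulas team satisfaction is classical satisfaction by every assignment.\<close>

fun erase_slashes :: "('f, 'r) ifml \<Rightarrow> ('f, 'r) fo" where
  "erase_slashes (Pos a) = FAtom a"
| "erase_slashes (Neg a) = FNot (FAtom a)"
| "erase_slashes (Conn Conj \<phi> \<psi>) = FAnd (erase_slashes \<phi>) (erase_slashes \<psi>)"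
| "erase_slashes (Conn Disj \<phi> \<psi>) = FOr (erase_slashes \<phi>) (erase_slashes \<psi>)"
| "erase_slashes (Quant Forall v V \<chi>) = FAll v (erase_slashes \<chi>)"
| "erase_slashes (Quant Exists v V \<chi>) = FEx v (erase_slashes \<chi>)"

lemma team_sat_quantifier_free:
  "quantifier_free \<psi> \<Longrightarrow> team_sat M X \<psi> \<longleftrightarrow> (\<forall>s\<in>X. fo_sat M s (erase_slashes \<psi>))"
proof (induction M X \<psi> rule: team_sat.induct)
  case (4 M X \<psi> \<chi>)
  show ?case
  proof
    assume "team_sat M X (Conn Disj \<psi> \<chi>)"
    then show "\<forall>s\<in>X. fo_sat M s (erase_slashes (Conn Disj \<psi> \<chi>))"
      using 4 by auto
  next
    assume sat: "\<forall>s\<in>X. fo_sat M s (erase_slashes (Conn Disj \<psi> \<chi>))"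
    let ?Y = "{s \<in> X. fo_sat M s (erase_slashes \<psi>)}"
    let ?Z = "{s \<in> X. fo_sat M s (erase_slashes \<chi>)}"
    have "X = ?Y \<union> ?Z" using sat by auto
    moreover have "team_sat M ?Y \<psi>" and "team_sat M ?Z \<chi>" using 4 by auto
    ultimately show "team_sat M X (Conn Disj \<psi> \<chi>)"
      unfolding team_sat.simps by blast
  qed
qed auto


section \<open>Positive initial syntactical trees\<close>

text \<open>
  A positive initial tree \<open>T\<close> has only connectives and quantifiers as nodes, and some of their
  successors may be missing. Each missing successor is recorded by \<open>Gap\<close>, so that a value of this
  type is literally the extended tree obtained from \<open>T\<close> by attaching the gap leaves; \<open>T\<close> itself
  consists of the nodes other than gaps.
\<close>

datatype itree =
    Gap
  | TConn conn itree itree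
  | TQuant quant var "var fset" itree

text \<open>
  A node is addressed by the list of steps that leads to it from the root. The only successor of
  a quantifier is reached by \<open>Fst\<close>.
\<close>

datatype step = Fst | Snd

type_synonym pos = "step list"

datatype label = LConn conn | LQuant quant var "var fset"

fun label_at :: "itree \<Rightarrow> pos \<Rightarrow> label option" where
  "label_at (TConn c l r) [] = Some (LConn c)"
| "label_at (TConn c l r) (Fst # p) = label_at l p"
| "label_at (TConn c l r) (Snd # p) = label_at r p"
| "label_at (TQuant Q v V t) [] = Some (LQuant Q v V)"
| "label_at (TQuant Q v V t) (Fst # p) = label_at t p"
| "label_at _ _ = None"

text \<open>
  A path, that is, a maximal chain of the extended tree, runs from the root to a gap and is
  represented by the address of that gap. Its nodes are those whose addresses are prefixes of it.
\<close>

fun paths :: "itree \<Rightarrow> pos set" where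
  "paths Gap = {[]}"
| "paths (TConn c l r) = (#) Fst ` paths l \<union> (#) Snd ` paths r"
| "paths (TQuant Q v V t) = (#) Fst ` paths t"

definition path_Bound :: "itree \<Rightarrow> pos \<Rightarrow> var set" where
  "path_Bound T P = {v. \<exists>p Q V. prefix p P \<and> label_at T p = Some (LQuant Q v V)}"

fun tree_FV :: "itree \<Rightarrow> var set" where
  "tree_FV Gap = {}"
| "tree_FV (TConn c l r) = tree_FV l \<union> tree_FV r"
| "tree_FV (TQuant Q v V t) = (tree_FV t - {v}) \<union> fset V"

fun tree_Bound :: "itree \<Rightarrow> var set" where
  "tree_Bound Gap = {}"
| "tree_Bound (TConn c l r) = tree_Bound l \<union> tree_Bound r"
| "tree_Bound (TQuant Q v V t) = insert v (tree_Bound t)"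

fun tree_no_requantification :: "itree \<Rightarrow> bool" where
  "tree_no_requantification Gap \<longleftrightarrow> True"
| "tree_no_requantification (TConn c l r) \<longleftrightarrow>
     tree_no_requantification l \<and> tree_no_requantification r"
| "tree_no_requantification (TQuant Q v V t) \<longleftrightarrow> v \<notin> tree_Bound t \<and> tree_no_requantification t"

definition regular_tree :: "itree \<Rightarrow> bool" where
  "regular_tree T \<longleftrightarrow> tree_FV T \<inter> tree_Bound T = {} \<and> tree_no_requantification T"


subsection \<open>Completing functions\<close>

text \<open>The values of \<open>e\<close> outside \<open>paths T\<close> are irrelevant.\<close>

definition completing :: "itree \<Rightarrow> (pos \<Rightarrow> ('f, 'r) ifml) \<Rightarrow> bool" where
  "completing T e \<longleftrightarrow> (\<forall>P\<in>paths T. regular (e P))"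

definition weak :: "itree \<Rightarrow> (pos \<Rightarrow> ('f, 'r) ifml) \<Rightarrow> bool" where
  "weak T e \<longleftrightarrow> (\<forall>P\<in>paths T. quantifier_free (e P))"

definition sentential :: "itree \<Rightarrow> (pos \<Rightarrow> ('f, 'r) ifml) \<Rightarrow> bool" where
  "sentential T e \<longleftrightarrow> (\<forall>P\<in>paths T. FV (e P) \<subseteq> path_Bound T P)"

fun fill_gaps :: "itree \<Rightarrow> (pos \<Rightarrow> ('f, 'r) ifml) \<Rightarrow> ('f, 'r) ifml" where
  "fill_gaps Gap e = e []"
| "fill_gaps (TConn c l r) e = Conn c (fill_gaps l (\<lambda>P. e (Fst # P))) (fill_gaps r (\<lambda>P. e (Snd # P)))"
| "fill_gaps (TQuant Q v V t) e = Quant Q v V (fill_gaps t (\<lambda>P. e (Fst # P)))"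


subsection \<open>Dependence and modest trees\<close>

definition quant_at :: "itree \<Rightarrow> quant \<Rightarrow> pos \<Rightarrow> bool" where
  "quant_at T Q p \<longleftrightarrow> (\<exists>v V. label_at T p = Some (LQuant Q v V))"

definition conn_at :: "itree \<Rightarrow> conn \<Rightarrow> pos \<Rightarrow> bool" where
  "conn_at T c p \<longleftrightarrow> label_at T p = Some (LConn c)"

abbreviation in_scope :: "pos \<Rightarrow> pos \<Rightarrow> bool" where
  "in_scope p q \<equiv> strict_prefix q p"

text \<open>\<open>depends T p q\<close>: the quantifier at \<open>p\<close> depends on the quantifier at \<open>q\<close>.\<close>

definition depends :: "itree \<Rightarrow> pos \<Rightarrow> pos \<Rightarrow> bool" where
  "depends T p q \<longleftrightarrow> in_scope p q \<and>
     (\<exists>Q y Y Q' x X. label_at T p = Some (LQuant Q y Y) \<and> label_at T q = Some (LQuant Q' x X) \<and>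
        x |\<notin>| Y)"

definition signalling_path :: "itree \<Rightarrow> pos \<Rightarrow> bool" where
  "signalling_path T P \<longleftrightarrow>
     (\<exists>x y z. prefix x P \<and> prefix y P \<and> prefix z P \<and>
        quant_at T Forall x \<and> quant_at T Exists y \<and> quant_at T Exists z \<and>
        depends T y x \<and> depends T z y \<and> \<not> depends T z x)"

definition signalling :: "itree \<Rightarrow> bool" where
  "signalling T \<longleftrightarrow> (\<exists>P\<in>paths T. signalling_path T P)"

text \<open>
  The slash sets of the universal quantifiers are arbitrary here: a slash set has no effect on the
  meaning of a universal quantifier.
\<close>

definition generalized_Henkin :: "itree \<Rightarrow> bool" where
  "generalized_Henkin T \<longleftrightarrow>
     (\<exists>x y u v.
        quant_at T Forall x \<and> quant_at T Forall y \<and> quant_at T Exists u \<and> quant_at T Exists v \<and>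
        in_scope u x \<and> in_scope v x \<and>
        depends T u x \<and> \<not> depends T u y \<and> \<not> depends T u v \<and>
        depends T v y \<and> \<not> depends T v x \<and> \<not> depends T v u)"

definition coordinated :: "itree \<Rightarrow> bool" where
  "coordinated T \<longleftrightarrow>
     (\<exists>x d y z u w.
        quant_at T Forall x \<and> conn_at T Disj d \<and> quant_at T Forall y \<and> quant_at T Forall z \<and>
        quant_at T Exists u \<and> quant_at T Exists w \<and>
        in_scope d x \<and> in_scope u d \<and> in_scope w d \<and>
        depends T u y \<and> \<not> depends T u x \<and> \<not> depends T u z \<and> \<not> depends T u w \<and>
        depends T w z \<and> \<not> depends T w x \<and> \<not> depends T w y \<and> \<not> depends T w u)"

definition modest :: "itree \<Rightarrow> bool" where
  "modest T \<longleftrightarrow> \<not> signalling T \<and> \<not> generalized_Henkin T \<and> \<not> coordinated T"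


section \<open>Definability on finite structures\<close>

text \<open>
  Every finite structure is isomorphic to one whose universe is a set of natural numbers, so a
  class of finite structures closed under isomorphism is determined by its members of this form.
\<close>

definition finite_models :: "('f, 'r) ifml \<Rightarrow> (nat, 'f, 'r) struct set" where
  "finite_models \<phi> = {M. finite_structure M \<and> if_true M \<phi>}"

definition fo_finite_models :: "('f, 'r) fo \<Rightarrow> (nat, 'f, 'r) struct set" where
  "fo_finite_models \<theta> = {M. finite_structure M \<and> fo_true M \<theta>}"

text \<open>The defining first-order sentence has to be in the vocabulary of the IF formula.\<close>

definition finite_models_FO_definable :: "('f, 'r) ifml \<Rightarrow> bool" where
  "finite_models_FO_definable \<phi> \<longleftrightarrow>
     (\<exists>\<theta>. fo_sentence \<theta> \<and> fo_syms \<theta> \<subseteq> syms \<phi> \<and> finite_models \<phi> = fo_finite_models \<theta>)"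

end

(*
  If the tree is not signalling, the value of an existential variable on a team is a function of the
  universal variables on which its quantifier depends. So the sentence says that there are Skolem
  functions, one for each existential quantifier u and with arguments in a set A(u) of universal
  variables above u, under which an ordinary first-order formula holds.

  These functions are eliminated by induction on the number of nodes. If some A(u) is empty, u can be
  moved to the front and becomes a parameter; if some x lies in every A(u), the universal quantifier
  on x can be moved to the front and becomes a parameter. Otherwise look at the first symbol after
  the leading universal quantifiers. A conjunction distributes over them and splits the problem, as
  does a disjunction without universal quantifiers in front of it. In the remaining cases, since the
  tree is neither generalized Henkin nor coordinated, a smallest A(u) shares a variable with all the
  others, so that one of the two moves was possible after all.
*)

theory Submission
  imports Defs
begin

section \<open>Formulas with explicit dependency sets\<close>

text \<open>The conditions on trees speak of nodes and of dependence between existentials, whereas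
  the formulas met during the elimination have lost quantifiers and gained parameters. They are
  therefore recast as conditions on pairs (U, A), where U collects the universal variables above an
  existential quantifier and A is its dependency set; these survive the removal of a variable from
  all sets. Dependence among existentials drops out of them: in a non-signalling tree it forces an
  inclusion of dependency sets, so it never occurs between quantifiers whose sets are incomparable.
  Quantifiers are extracted from any depth. A Skolem function without arguments is a constant
  wherever it is used, and a variable x read by every Skolem function forces all existentials below
  the quantifier on x, so that none obstructs its move. Both moves rely on distinct names for bound
  variables, while a regular tree may quantify one variable in parallel branches; hence variables
  are renamed after positions. The obstacle is a disjunction behind a universal prefix, where the
  choice of the disjunct may vary with the prefix.\<close>

datatype ('f, 'r) dform =
    DLeaf "('f, 'r) fo"
  | DConn conn "('f, 'r) dform" "('f, 'r) dform"
  | DAll var "('f, 'r) dform"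
  | DEx var "var set" "('f, 'r) dform"

text \<open>A Skolem function receives the restriction of the current assignment to its dependency
  set, which spares fixing an arity or an order of its arguments.\<close>

fun skolem_holds ::
    "('a, 'f, 'r) struct \<Rightarrow> (var \<Rightarrow> 'a assignment \<Rightarrow> 'a) \<Rightarrow> 'a assignment \<Rightarrow> ('f, 'r) dform \<Rightarrow> bool" where
  "skolem_holds M F s (DLeaf \<phi>) \<longleftrightarrow> fo_sat M s \<phi>"
| "skolem_holds M F s (DConn Conj g h) \<longleftrightarrow> skolem_holds M F s g \<and> skolem_holds M F s h"
| "skolem_holds M F s (DConn Disj g h) \<longleftrightarrow> skolem_holds M F s g \<or> skolem_holds M F s h"
| "skolem_holds M F s (DAll x g) \<longleftrightarrow> (\<forall>a\<in>univ M. skolem_holds M F (s(x \<mapsto> a)) g)"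
| "skolem_holds M F s (DEx u A g) \<longleftrightarrow> skolem_holds M F (s(u \<mapsto> F u (s |` A))) g"

text \<open>Values lie in the universe at every argument, so strategies can be cut and glued without
  tracking which arguments actually occur.\<close>

definition strategy :: "('a, 'f, 'r) struct \<Rightarrow> (var \<Rightarrow> 'a assignment \<Rightarrow> 'a) \<Rightarrow> bool" where
  "strategy M F \<longleftrightarrow> (\<forall>u t. F u t \<in> univ M)"

definition skolem_sat :: "('a, 'f, 'r) struct \<Rightarrow> 'a assignment \<Rightarrow> ('f, 'r) dform \<Rightarrow> bool" where
  "skolem_sat M s g \<longleftrightarrow> (\<exists>F. strategy M F \<and> skolem_holds M F s g)"

fun free :: "('f, 'r) dform \<Rightarrow> var set" where
  "free (DLeaf \<phi>) = fo_FV \<phi>"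
| "free (DConn c g h) = free g \<union> free h"
| "free (DAll x g) = free g - {x}"
| "free (DEx u A g) = free g - {u}"

fun bnd :: "('f, 'r) dform \<Rightarrow> var set" where
  "bnd (DLeaf \<phi>) = {}"
| "bnd (DConn c g h) = bnd g \<union> bnd h"
| "bnd (DAll x g) = insert x (bnd g)"
| "bnd (DEx u A g) = insert u (bnd g)"

fun deps :: "('f, 'r) dform \<Rightarrow> var set" where
  "deps (DLeaf \<phi>) = {}"
| "deps (DConn c g h) = deps g \<union> deps h"
| "deps (DAll x g) = deps g"
| "deps (DEx u A g) = A \<union> deps g"

fun occ :: "('f, 'r) dform \<Rightarrow> var set" where
  "occ (DLeaf \<phi>) = fo_FV \<phi>"
| "occ (DConn c g h) = occ g \<union> occ h"
| "occ (DAll x g) = insert x (occ g)"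
| "occ (DEx u A g) = insert u (A \<union> occ g)"

fun dsyms :: "('f, 'r) dform \<Rightarrow> ('f, 'r) symbol set" where
  "dsyms (DLeaf \<phi>) = fo_syms \<phi>"
| "dsyms (DConn c g h) = dsyms g \<union> dsyms h"
| "dsyms (DAll x g) = dsyms g"
| "dsyms (DEx u A g) = dsyms g"

fun nodes :: "('f, 'r) dform \<Rightarrow> nat" where
  "nodes (DLeaf \<phi>) = 1"
| "nodes (DConn c g h) = Suc (nodes g + nodes h)"
| "nodes (DAll x g) = Suc (nodes g)"
| "nodes (DEx u A g) = Suc (nodes g)"

text \<open>Besides giving each variable at most one binder, this keeps an existential variable from
  being an argument below its own quantifier, and an argument from being bound below the quantifier
  that reads it. Quantifiers can then be moved without capture.\<close>

fun apart :: "('f, 'r) dform \<Rightarrow> bool" where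
  "apart (DLeaf \<phi>) \<longleftrightarrow> True"
| "apart (DConn c g h) \<longleftrightarrow> apart g \<and> apart h \<and> bnd g \<inter> occ h = {} \<and> bnd h \<inter> occ g = {}"
| "apart (DAll x g) \<longleftrightarrow> x \<notin> bnd g \<and> apart g"
| "apart (DEx u A g) \<longleftrightarrow> u \<notin> bnd g \<and> u \<notin> deps g \<and> A \<inter> bnd g = {} \<and> apart g"

text \<open>The variable becomes a free parameter. It also leaves the dependency sets, since a
  Skolem function need not be told the value of a fixed parameter.\<close>

fun del :: "var \<Rightarrow> ('f, 'r) dform \<Rightarrow> ('f, 'r) dform" where
  "del x (DLeaf \<phi>) = DLeaf \<phi>"
| "del x (DConn c g h) = DConn c (del x g) (del x h)"
| "del x (DAll y g) = (if y = x then del x g else DAll y (del x g))"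
| "del x (DEx u A g) = (if u = x then del x g else DEx u (A - {x}) (del x g))"

text \<open>
  One pair for each existential quantifier: the universal variables above it, among which are
  those in \<open>P\<close>, and its dependency set.
\<close>

fun exs :: "var set \<Rightarrow> ('f, 'r) dform \<Rightarrow> (var set \<times> var set) set" where
  "exs P (DLeaf \<phi>) = {}"
| "exs P (DConn c g h) = exs P g \<union> exs P h"
| "exs P (DAll x g) = exs (insert x P) g"
| "exs P (DEx u A g) = insert (P, A) (exs P g)"

section \<open>Deleting a variable\<close>

lemma bnd_subset_occ: "bnd g \<subseteq> occ g"
  by (induction g) auto

lemma deps_subset_occ: "deps g \<subseteq> occ g"
  by (induction g) auto

lemma del_fresh: "x \<notin> bnd g \<Longrightarrow> x \<notin> deps g \<Longrightarrow> del x g = g"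
  by (induction g) auto

lemma free_del: "free (del x g) \<subseteq> insert x (free g)"
  by (induction g) auto

lemma bnd_del: "bnd (del x g) = bnd g - {x}"
  by (induction g) (simp_all add: Un_Diff insert_Diff_if)

lemma deps_del: "deps (del x g) \<subseteq> deps g"
  by (induction g) auto

lemma occ_del: "occ (del x g) \<subseteq> occ g"
  by (induction g) auto

lemma dsyms_del: "dsyms (del x g) = dsyms g"
  by (induction g) auto

lemma nodes_del_le: "nodes (del x g) \<le> nodes g"
  by (induction g) auto

lemma nodes_del_less: "x \<in> bnd g \<Longrightarrow> nodes (del x g) < nodes g"
proof (induction g)
  case (DConn c g h)
  then show ?case using nodes_del_le[of x g] nodes_del_le[of x h] by fastforce
next
  case (DAll y g)
  then show ?case using nodes_del_le[of x g] by auto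
next
  case (DEx u A g)
  then show ?case using nodes_del_le[of x g] by auto
qed simp

lemma apart_del: "apart g \<Longrightarrow> apart (del x g)"
proof (induction g)
  case (DConn c g h)
  then show ?case using occ_del[of x g] occ_del[of x h] by (auto simp: bnd_del)
next
  case (DEx u A g)
  then show ?case using deps_del[of x g] by (auto simp: bnd_del)
qed (auto simp: bnd_del)

section \<open>Coincidence lemmas for assignments and strategies\<close>

lemma trm_val_cong: "\<forall>v\<in>trm_vars t. s v = s' v \<Longrightarrow> trm_val M s t = trm_val M s' t"
proof (induction t)
  case (Fun f ts)
  then have "map (trm_val M s) ts = map (trm_val M s') ts" by auto
  then show ?case by (metis trm_val.simps(2))
qed simp

lemma atom_holds_cong:
  assumes "\<forall>v\<in>atom_vars a. s v = s' v"
  shows "atom_holds M s a \<longleftrightarrow> atom_holds M s' a"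
proof (cases a)
  case (Equal t u)
  then show ?thesis using assms trm_val_cong[of t s s' M] trm_val_cong[of u s s' M] by auto
next
  case (Rel r ts)
  then have "map (trm_val M s) ts = map (trm_val M s') ts"
    using assms trm_val_cong[of _ s s' M] by auto
  then show ?thesis using Rel by (metis atom_holds.simps(2))
qed

lemma fo_sat_cong: "\<forall>v\<in>fo_FV \<phi>. s v = s' v \<Longrightarrow> fo_sat M s \<phi> \<longleftrightarrow> fo_sat M s' \<phi>"
proof (induction \<phi> arbitrary: s s')
  case (FAtom a)
  then show ?case using atom_holds_cong[of a s s' M] by simp
next
  case (FEx x \<phi>)
  then have "fo_sat M (s(x \<mapsto> a)) \<phi> = fo_sat M (s'(x \<mapsto> a)) \<phi>" for a
    by (intro FEx.IH) auto
  then show ?case by simp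
next
  case (FAll x \<phi>)
  then have "fo_sat M (s(x \<mapsto> a)) \<phi> = fo_sat M (s'(x \<mapsto> a)) \<phi>" for a
    by (intro FAll.IH) auto
  then show ?case by simp
next
  case (FNot \<phi>)
  then show ?case using FNot.IH[of s s'] by simp
next
  case (FAnd \<phi> \<psi>)
  then have "fo_sat M s \<phi> = fo_sat M s' \<phi>" "fo_sat M s \<psi> = fo_sat M s' \<psi>"
    by (intro FAnd.IH; simp)+
  then show ?case by simp
next
  case (FOr \<phi> \<psi>)
  then have "fo_sat M s \<phi> = fo_sat M s' \<phi>" "fo_sat M s \<psi> = fo_sat M s' \<psi>"
    by (intro FOr.IH; simp)+
  then show ?case by simp
qed

lemma skolem_holds_cong:
  "\<forall>v\<in>occ g. s v = s' v \<Longrightarrow> skolem_holds M F s g \<longleftrightarrow> skolem_holds M F s' g"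
proof (induction g arbitrary: s s')
  case (DLeaf \<phi>)
  then show ?case by (simp add: fo_sat_cong)
next
  case (DConn c g h)
  then have "skolem_holds M F s g = skolem_holds M F s' g" "skolem_holds M F s h = skolem_holds M F s' h"
    by (intro DConn.IH; simp)+
  then show ?case by (cases c) auto
next
  case (DAll x g)
  then have "skolem_holds M F (s(x \<mapsto> a)) g = skolem_holds M F (s'(x \<mapsto> a)) g" for a
    by (intro DAll.IH) auto
  then show ?case by simp
next
  case (DEx u A g)
  then have "s |` A = s' |` A" by (auto simp: restrict_map_def)
  moreover have "skolem_holds M F (s(u \<mapsto> a)) g = skolem_holds M F (s'(u \<mapsto> a)) g" for a
    using DEx.prems by (intro DEx.IH) auto
  ultimately show ?case by simp
qed

lemma skolem_holds_cong_strategy: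
  "\<forall>u\<in>bnd g. F u = F' u \<Longrightarrow> skolem_holds M F s g \<longleftrightarrow> skolem_holds M F' s g"
proof (induction g arbitrary: s)
  case (DConn c g h)
  then show ?case by (cases c) auto
qed auto

lemma skolem_holds_fresh:
  "x \<notin> occ g \<Longrightarrow> skolem_holds M F (s(x \<mapsto> a)) g \<longleftrightarrow> skolem_holds M F s g"
  by (rule skolem_holds_cong) auto

lemma skolem_holds_no_exs:
  "exs P g = {} \<Longrightarrow> skolem_holds M F s g \<longleftrightarrow> skolem_holds M F' s g"
proof (induction g arbitrary: P s)
  case (DConn c g h)
  then have "skolem_holds M F s g = skolem_holds M F' s g" "skolem_holds M F s h = skolem_holds M F' s h"
    by auto
  then show ?case by (cases c) auto
qed auto

lemma strategy_exists:
  assumes "univ M \<noteq> {}"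
  shows "\<exists>F. strategy M F"
proof -
  obtain a where "a \<in> univ M" using assms by auto
  then have "strategy M (\<lambda>_ _. a)" by (simp add: strategy_def)
  then show ?thesis by blast
qed

subsection \<open>Good dependency patterns\<close>

text \<open>At a disjunction, \<open>P\<close> consists of the universal variables above it. A
  violation supplies an element of \<open>P\<close> outside both sets, one of \<open>A - A'\<close>
  and one of \<open>A' - A\<close>: the variables x, y and z of a coordinated tree.\<close>

fun coord_free :: "var set \<Rightarrow> ('f, 'r) dform \<Rightarrow> bool" where
  "coord_free P (DLeaf \<phi>) \<longleftrightarrow> True"
| "coord_free P (DConn c g h) \<longleftrightarrow> coord_free P g \<and> coord_free P h \<and>
     (c = Disj \<longrightarrow> (\<forall>U A U' A'. (U, A) \<in> exs P (DConn c g h) \<longrightarrow> (U', A') \<in> exs P (DConn c g h) \<longrightarrow>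
        P \<subseteq> A \<union> A' \<or> A \<subseteq> A' \<or> A' \<subseteq> A))"
| "coord_free P (DAll x g) \<longleftrightarrow> coord_free (insert x P) g"
| "coord_free P (DEx u A g) \<longleftrightarrow> coord_free P g"

text \<open>Here \<open>x\<close> plays the universal variable above both existentials of a
  generalized Henkin tree, and an element of \<open>A' - A\<close> would play y, which need not lie
  above the other existential.\<close>

definition henkin_free :: "(var set \<times> var set) set \<Rightarrow> bool" where
  "henkin_free E \<longleftrightarrow> (\<forall>U A. (U, A) \<in> E \<longrightarrow> A \<subseteq> U) \<and>
     (\<forall>U A U' A' x. (U, A) \<in> E \<longrightarrow> (U', A') \<in> E \<longrightarrow> x \<in> U \<inter> U' \<longrightarrow> x \<in> A - A' \<longrightarrow> A' \<subseteq> A)"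

definition good :: "('f, 'r) dform \<Rightarrow> bool" where
  "good g \<longleftrightarrow> apart g \<and> henkin_free (exs {} g) \<and> coord_free {} g"

text \<open>Pairs disappear if the deleted variable is existential, and otherwise only lose
  \<open>x\<close>. Inclusions and coverings by a union survive this, which closes both pattern
  conditions under deletion.\<close>

lemma exs_del:
  assumes "(U, A) \<in> exs (P - {x}) (del x g)"
  shows "\<exists>U' A'. (U', A') \<in> exs P g \<and> U = U' - {x} \<and> A = A' - {x}"
  using assms
proof (induction g arbitrary: P)
  case (DConn c g h)
  from DConn.prems consider "(U, A) \<in> exs (P - {x}) (del x g)" | "(U, A) \<in> exs (P - {x}) (del x h)" by auto
  then show ?case
  proof cases
    case 1
    from DConn.IH(1)[OF this] show ?thesis unfolding exs.simps by blast
  next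
    case 2
    from DConn.IH(2)[OF this] show ?thesis unfolding exs.simps by blast
  qed
next
  case (DAll y g)
  have "insert y P - {x} = (if y = x then P - {x} else insert y (P - {x}))" by auto
  then have "(U, A) \<in> exs (insert y P - {x}) (del x g)" using DAll.prems by (simp split: if_splits)
  then show ?case using DAll.IH[of "insert y P"] by simp
next
  case (DEx u B g)
  then have "(U, A) \<in> exs (P - {x}) (del x g) \<or> U = P - {x} \<and> A = B - {x}" by (simp split: if_splits) metis
  then show ?case
  proof
    assume "(U, A) \<in> exs (P - {x}) (del x g)"
    from DEx.IH[OF this] show ?thesis unfolding exs.simps by blast
  qed auto
qed simp

lemma henkin_free_mono: "henkin_free E \<Longrightarrow> E' \<subseteq> E \<Longrightarrow> henkin_free E'"
  unfolding henkin_free_def by (meson subsetD)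

lemma henkin_free_scope: "henkin_free E \<Longrightarrow> (U, A) \<in> E \<Longrightarrow> A \<subseteq> U"
  unfolding henkin_free_def by meson

lemma henkin_free_subset:
  "henkin_free E \<Longrightarrow> (U, A) \<in> E \<Longrightarrow> (U', A') \<in> E \<Longrightarrow> x \<in> U \<inter> U' \<Longrightarrow> x \<in> A - A' \<Longrightarrow> A' \<subseteq> A"
  unfolding henkin_free_def by meson

lemma henkin_free_del:
  assumes "henkin_free (exs P g)"
  shows "henkin_free (exs (P - {x}) (del x g))"
  unfolding henkin_free_def
proof (intro conjI allI impI)
  fix U A assume "(U, A) \<in> exs (P - {x}) (del x g)"
  from exs_del[OF this] henkin_free_scope[OF assms] show "A \<subseteq> U" by blast
next
  fix U A U' A' y
  assume 1: "(U, A) \<in> exs (P - {x}) (del x g)" and 2: "(U', A') \<in> exs (P - {x}) (del x g)"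
    and y: "y \<in> U \<inter> U'" "y \<in> A - A'"
  obtain V B where B: "(V, B) \<in> exs P g" "U = V - {x}" "A = B - {x}" using exs_del[OF 1] by auto
  obtain V' B' where B': "(V', B') \<in> exs P g" "U' = V' - {x}" "A' = B' - {x}" using exs_del[OF 2] by auto
  have "B' \<subseteq> B" by (rule henkin_free_subset[OF assms B(1) B'(1), of y]) (use y B B' in auto)
  then show "A' \<subseteq> A" using B B' by blast
qed

lemma coord_free_del: "coord_free P g \<Longrightarrow> coord_free (P - {x}) (del x g)"
proof (induction g arbitrary: P)
  case (DConn c g h)
  have "P - {x} \<subseteq> A \<union> A' \<or> A \<subseteq> A' \<or> A' \<subseteq> A"
    if "c = Disj" and 1: "(U, A) \<in> exs (P - {x}) (del x (DConn c g h))"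
      and 2: "(U', A') \<in> exs (P - {x}) (del x (DConn c g h))" for U A U' A'
  proof -
    obtain V B where B: "(V, B) \<in> exs P (DConn c g h)" "A = B - {x}" using exs_del[OF 1] by auto
    obtain V' B' where B': "(V', B') \<in> exs P (DConn c g h)" "A' = B' - {x}" using exs_del[OF 2] by auto
    have "P \<subseteq> B \<union> B' \<or> B \<subseteq> B' \<or> B' \<subseteq> B" using DConn.prems that(1) B(1) B'(1)
      unfolding coord_free.simps by blast
    then show ?thesis using B B' by blast
  qed
  moreover have "coord_free (P - {x}) (del x g)" "coord_free (P - {x}) (del x h)"
    using DConn by auto
  ultimately show ?case unfolding del.simps coord_free.simps by blast
next
  case (DAll y g)
  have "insert y P - {x} = (if y = x then P - {x} else insert y (P - {x}))" by auto
  then show ?case using DAll.IH[of "insert y P"] DAll.prems by (simp split: if_splits)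
qed auto

lemma good_del: "good g \<Longrightarrow> good (del x g)"
  using apart_del[of g x] henkin_free_del[of "{}" g x] coord_free_del[of "{}" g x]
  by (simp add: good_def)

subsection \<open>Moving quantifiers to the front\<close>

lemma skolem_holds_DConn:
  "skolem_holds M F s (DConn c g h) \<longleftrightarrow>
     (if c = Conj then skolem_holds M F s g \<and> skolem_holds M F s h
      else skolem_holds M F s g \<or> skolem_holds M F s h)"
  by (cases c) auto

text \<open>With no arguments, the function for \<open>u\<close> takes one value throughout, even
  below universal quantifiers, so this value can be assigned in advance; a sibling branch does not
  mention \<open>u\<close>. The choice of \<open>u\<close> precedes that of the structure because a
  single first-order formula has to serve all structures.\<close>

lemma skolem_holds_pull_ex:
  fixes g :: "('f, 'r) dform"
  assumes "(U, {}) \<in> exs P g" and "apart g"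
  shows "\<exists>u\<in>bnd g. \<forall>(M :: ('a, 'f, 'r) struct) F s. skolem_holds M F s g \<longleftrightarrow>
           skolem_holds M F (s(u \<mapsto> F u Map.empty)) (del u g)"
  using assms
proof (induction g arbitrary: P)
  case (DConn c g h)
  have absent: "skolem_holds M F (s(u \<mapsto> a)) (del u h') \<longleftrightarrow> skolem_holds M F s h'"
    if "u \<notin> occ h'" for u a F s and M :: "('a, 'f, 'r) struct" and h' :: "('f, 'r) dform"
  proof -
    have "del u h' = h'" using that bnd_subset_occ[of h'] deps_subset_occ[of h'] by (intro del_fresh) auto
    then show ?thesis by (simp only: skolem_holds_fresh[OF that])
  qed
  have apart: "apart g" "apart h" using DConn.prems(2) by auto
  from DConn.prems consider "(U, {}) \<in> exs P g" | "(U, {}) \<in> exs P h" by auto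
  then show ?case
  proof cases
    case 1
    from DConn.IH(1)[OF 1 apart(1)] obtain u where u: "u \<in> bnd g" and
      eq: "\<And>(M :: ('a, 'f, 'r) struct) F s. skolem_holds M F (s(u \<mapsto> F u Map.empty)) (del u g) \<longleftrightarrow>
         skolem_holds M F s g" by blast
    have fresh: "u \<notin> occ h" using u DConn.prems(2) by auto
    show ?thesis using u
      by (intro bexI[of _ u] allI) (simp_all only: del.simps skolem_holds_DConn eq absent[OF fresh] bnd.simps Un_iff simp_thms)
  next
    case 2
    from DConn.IH(2)[OF 2 apart(2)] obtain u where u: "u \<in> bnd h" and
      eq: "\<And>(M :: ('a, 'f, 'r) struct) F s. skolem_holds M F (s(u \<mapsto> F u Map.empty)) (del u h) \<longleftrightarrow>
         skolem_holds M F s h" by blast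
    have fresh: "u \<notin> occ g" using u DConn.prems(2) by auto
    show ?thesis using u
      by (intro bexI[of _ u] allI) (simp_all only: del.simps skolem_holds_DConn eq absent[OF fresh] bnd.simps Un_iff simp_thms)
  qed
next
  case (DAll x g)
  then have "apart g" "(U, {}) \<in> exs (insert x P) g" by simp_all
  from DAll.IH[OF this(2,1)] obtain u where u: "u \<in> bnd g" and
    eq: "\<And>(M :: ('a, 'f, 'r) struct) F s. skolem_holds M F (s(u \<mapsto> F u Map.empty)) (del u g) \<longleftrightarrow>
       skolem_holds M F s g" by blast
  then have "x \<noteq> u" using DAll.prems by auto
  then have neq: "(x = u) = False" and twist: "s(u \<mapsto> a, x \<mapsto> b) = s(x \<mapsto> b, u \<mapsto> a)"
    for s :: "'a assignment" and a b by (auto simp: fun_upd_twist)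
  have "skolem_holds M F (s(u \<mapsto> F u Map.empty)) (del u (DAll x g)) \<longleftrightarrow> skolem_holds M F s (DAll x g)"
    for M :: "('a, 'f, 'r) struct" and F s
    by (simp only: del.simps neq if_False skolem_holds.simps twist eq)
  then show ?case using u unfolding bnd.simps by blast
next
  case (DEx v A g)
  show ?case
  proof (cases "A = {}")
    case True
    have "del v g = g" using DEx.prems by (intro del_fresh) auto
    then have "skolem_holds M F (s(v \<mapsto> F v Map.empty)) (del v (DEx v A g)) \<longleftrightarrow> skolem_holds M F s (DEx v A g)"
      for M :: "('a, 'f, 'r) struct" and F s using True by simp
    then show ?thesis unfolding bnd.simps by blast
  next
    case False
    then have "apart g" "(U, {}) \<in> exs P g" using DEx.prems by auto
    from DEx.IH[OF this(2,1)] obtain u where u: "u \<in> bnd g" and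
      eq: "\<And>(M :: ('a, 'f, 'r) struct) F s. skolem_holds M F (s(u \<mapsto> F u Map.empty)) (del u g) \<longleftrightarrow>
         skolem_holds M F s g" by blast
    have "v \<noteq> u" "u \<notin> A" using u DEx.prems by auto
    moreover from \<open>u \<notin> A\<close> have "(s(u \<mapsto> a)) |` (A - {u}) = s |` A" for s :: "'a assignment" and a
      by auto
    moreover from \<open>v \<noteq> u\<close> have "(v = u) = False" "s(u \<mapsto> a, v \<mapsto> b) = s(v \<mapsto> b, u \<mapsto> a)"
      for s :: "'a assignment" and a b by (auto simp: fun_upd_twist)
    ultimately have "skolem_holds M F (s(u \<mapsto> F u Map.empty)) (del u (DEx v A g)) \<longleftrightarrow> skolem_holds M F s (DEx v A g)"
      for M :: "('a, 'f, 'r) struct" and F s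
      by (simp only: del.simps if_False skolem_holds.simps eq)
    then show ?thesis using u unfolding bnd.simps by blast
  qed
qed auto

lemma skolem_sat_pull_ex:
  assumes "(U, {}) \<in> exs P g" and "apart g"
  shows "\<exists>u\<in>bnd g. \<forall>(M :: ('a, 'f, 'r) struct) s. skolem_sat M s g \<longleftrightarrow> (\<exists>a\<in>univ M. skolem_sat M (s(u \<mapsto> a)) (del u g))"
proof -
  from skolem_holds_pull_ex[OF assms] obtain u where u: "u \<in> bnd g" and
    eq: "\<And>(M :: ('a, 'f, 'r) struct) F s. skolem_holds M F s g \<longleftrightarrow> skolem_holds M F (s(u \<mapsto> F u Map.empty)) (del u g)"
    by blast
  have "skolem_sat M s g" if "a \<in> univ M" "skolem_sat M (s(u \<mapsto> a)) (del u g)"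
    for M :: "('a, 'f, 'r) struct" and s a
  proof -
    from that(2) obtain F where F: "strategy M F" "skolem_holds M F (s(u \<mapsto> a)) (del u g)"
      unfolding skolem_sat_def by auto
    \<comment> \<open>As \<open>del u g\<close> no longer binds \<open>u\<close>, changing the
      strategy there is harmless, and it turns the chosen element into the value of the
      constant.\<close>
    let ?F = "F(u := \<lambda>_. a)"
    have "skolem_holds M ?F (s(u \<mapsto> a)) (del u g)"
      using F(2) by (subst skolem_holds_cong_strategy[of _ _ F]) (auto simp: bnd_del)
    moreover have "strategy M ?F" using F(1) that(1) by (auto simp: strategy_def)
    ultimately show ?thesis using eq[of M ?F s] unfolding skolem_sat_def by auto
  qed
  moreover have "\<exists>a\<in>univ M. skolem_sat M (s(u \<mapsto> a)) (del u g)" if "skolem_sat M s g"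
    for M :: "('a, 'f, 'r) struct" and s
    using that eq[of M _ s] unfolding skolem_sat_def strategy_def by blast
  ultimately show ?thesis using u by blast
qed

lemma exs_subset: "(U, A) \<in> exs P g \<Longrightarrow> U \<subseteq> P \<union> bnd g"
  by (induction g arbitrary: P) fastforce+

text \<open>Once \<open>x\<close> has a value, a function that reads \<open>x\<close> can have this
  value built in: adding it to the restriction to \<open>A - {x}\<close> restores the restriction to
  \<open>A\<close>.\<close>

lemma skolem_holds_del_bound:
  assumes "\<forall>(U, A)\<in>exs P g. x \<in> A" and "x \<notin> bnd g" and "s x = Some a"
  shows "skolem_holds M F s g \<longleftrightarrow> skolem_holds M (\<lambda>u t. F u (t(x \<mapsto> a))) s (del x g)"
  using assms
proof (induction g arbitrary: P s)
  case (DConn c g h)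
  then show ?case using DConn.IH(1)[of P s] DConn.IH(2)[of P s] by (cases c) auto
next
  case (DEx u A g)
  have A: "(s |` (A - {x}))(x \<mapsto> a) = s |` A"
    using DEx.prems by (auto simp: restrict_map_def fun_eq_iff)
  have "x \<noteq> u" using DEx.prems by auto
  then have "(s(u \<mapsto> b)) x = Some a" for b using DEx.prems by simp
  moreover have "\<forall>(U, A)\<in>exs P g. x \<in> A" "x \<notin> bnd g" using DEx.prems by auto
  ultimately have IH: "skolem_holds M F (s(u \<mapsto> b)) g \<longleftrightarrow>
      skolem_holds M (\<lambda>u t. F u (t(x \<mapsto> a))) (s(u \<mapsto> b)) (del x g)" for b
    by (intro DEx.IH)
  have "(u = x) = False" using \<open>x \<noteq> u\<close> by auto
  then show ?case by (simp only: del.simps skolem_holds.simps A IH if_False)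
next
  case (DAll y g)
  then show ?case using DAll.IH[of "insert y P"] by auto
qed simp

text \<open>An existential quantifier here would read \<open>x\<close>, which is universally
  quantified neither above it nor within the formula. Hence a branch beside the quantifier on
  \<open>x\<close> contains no existentials at all.\<close>

lemma exs_empty_if_absent:
  assumes "\<forall>(U, A)\<in>exs P g. A \<subseteq> U \<and> x \<in> A" and "x \<notin> P" and "x \<notin> bnd g"
  shows "exs P g = {}"
  using assms exs_subset by fastforce

text \<open>No existential quantifier lies above the one on \<open>x\<close>, since its dependency
  set would contain \<open>x\<close> without having it in scope, and none lies beside it. The
  quantifier thus only has to pass universal quantifiers and connectives whose other branch does not
  depend on \<open>x\<close> or on the strategy; over a nonempty universe it commutes with all of
  these.\<close>

lemma skolem_holds_pull_all:
  fixes g :: "('f, 'r) dform"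
  assumes "\<forall>(U, A)\<in>exs P g. A \<subseteq> U \<and> x \<in> A" and "x \<notin> P" and "x \<in> bnd g" and "apart g"
    and "univ M \<noteq> {}"
  shows "skolem_holds M F s g \<longleftrightarrow>
           (\<forall>a\<in>univ M. skolem_holds M (\<lambda>u t. F u (t(x \<mapsto> a))) (s(x \<mapsto> a)) (del x g))"
  using assms
proof (induction g arbitrary: P s)
  case (DConn c g h)
  let ?F = "\<lambda>a u t. F u (t(x \<mapsto> a))"
  have indep: "skolem_holds M (?F a) (s(x \<mapsto> a)) (del x h') = skolem_holds M F s h'"
    if "exs P h' = {}" "x \<notin> occ h'" for h' :: "('f, 'r) dform" and a
  proof -
    have "del x h' = h'" using that bnd_subset_occ[of h'] deps_subset_occ[of h'] by (intro del_fresh) auto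
    then show ?thesis using skolem_holds_no_exs[OF that(1), of M "?F a" s F]
      by (simp only: skolem_holds_fresh[OF that(2)])
  qed
  from DConn.prems consider "x \<in> bnd g" "x \<notin> occ h" | "x \<in> bnd h" "x \<notin> occ g" by auto
  then show ?case
  proof cases
    case 1
    have "exs P h = {}" using DConn.prems 1 bnd_subset_occ[of h]
      by (intro exs_empty_if_absent[of _ _ x]) auto
    moreover have "skolem_holds M F s g \<longleftrightarrow> (\<forall>a\<in>univ M. skolem_holds M (?F a) (s(x \<mapsto> a)) (del x g))"
      by (rule DConn.IH(1)[of P]) (use DConn.prems 1 in auto)
    ultimately show ?thesis using indep[of h] 1(2) DConn.prems(5)
      by (simp only: del.simps skolem_holds_DConn) auto
  next
    case 2
    have "exs P g = {}" using DConn.prems 2 bnd_subset_occ[of g]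
      by (intro exs_empty_if_absent[of _ _ x]) auto
    moreover have "skolem_holds M F s h \<longleftrightarrow> (\<forall>a\<in>univ M. skolem_holds M (?F a) (s(x \<mapsto> a)) (del x h))"
      by (rule DConn.IH(2)[of P]) (use DConn.prems 2 in auto)
    ultimately show ?thesis using indep[of g] 2(2) DConn.prems(5)
      by (simp only: del.simps skolem_holds_DConn) auto
  qed
next
  case (DAll y g)
  show ?case
  proof (cases "y = x")
    case True
    have "skolem_holds M F (s(x \<mapsto> a)) g \<longleftrightarrow>
       skolem_holds M (\<lambda>u t. F u (t(x \<mapsto> a))) (s(x \<mapsto> a)) (del x g)" for a
      using DAll.prems True by (intro skolem_holds_del_bound[of "insert x P"]) auto
    then show ?thesis using True by (simp only: del.simps skolem_holds.simps if_True simp_thms)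
  next
    case False
    have "skolem_holds M F (s(y \<mapsto> b)) g \<longleftrightarrow>
        (\<forall>a\<in>univ M. skolem_holds M (\<lambda>u t. F u (t(x \<mapsto> a))) (s(y \<mapsto> b, x \<mapsto> a)) (del x g))" for b
      by (rule DAll.IH[of "insert y P"]) (use DAll.prems False in auto)
    moreover have "s(y \<mapsto> b, x \<mapsto> a) = s(x \<mapsto> a, y \<mapsto> b)" for a b using False by (simp add: fun_upd_twist)
    ultimately show ?thesis using False by (simp only: del.simps skolem_holds.simps if_False) blast
  qed
qed auto

text \<open>After deletion no dependency set contains \<open>x\<close>, so an argument never carries
  a value for it. This reconciles the glued strategy of the next lemma with the strategies it is
  made of.\<close>

lemma skolem_holds_del_ignores:
  "skolem_holds M (\<lambda>u t. G u (t(x := None))) s (del x g) \<longleftrightarrow> skolem_holds M G s (del x g)"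
proof (induction g arbitrary: s)
  case (DConn c g h)
  then show ?case by (simp only: del.simps skolem_holds_DConn)
next
  case (DAll y g)
  then show ?case by (cases "y = x") (simp_all only: del.simps skolem_holds.simps if_True if_False simp_thms)
next
  case (DEx u A g)
  have "(s |` (A - {x}))(x := None) = s |` (A - {x})"
    by (auto simp: restrict_map_def fun_eq_iff)
  then show ?case
    by (cases "u = x") (simp_all only: del.simps skolem_holds.simps if_True if_False simp_thms DEx.IH)
qed (simp only: del.simps skolem_holds.simps)

lemma skolem_sat_pull_all:
  assumes "\<forall>(U, A)\<in>exs {} g. A \<subseteq> U \<and> x \<in> A" and "x \<in> bnd g" and "apart g" and "univ M \<noteq> {}"
  shows "skolem_sat M s g \<longleftrightarrow> (\<forall>a\<in>univ M. skolem_sat M (s(x \<mapsto> a)) (del x g))"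
proof -
  have eq: "skolem_holds M F s g \<longleftrightarrow>
           (\<forall>a\<in>univ M. skolem_holds M (\<lambda>u t. F u (t(x \<mapsto> a))) (s(x \<mapsto> a)) (del x g))" for F
    using skolem_holds_pull_all[of "{}" g x M F s] assms by auto
  show ?thesis
  proof
    assume "skolem_sat M s g"
    then obtain F where F: "strategy M F" "skolem_holds M F s g" unfolding skolem_sat_def by auto
    have "strategy M (\<lambda>u t. F u (t(x \<mapsto> a)))" for a using F(1) by (auto simp: strategy_def)
    then show "\<forall>a\<in>univ M. skolem_sat M (s(x \<mapsto> a)) (del x g)"
      using F(2) eq[of F] unfolding skolem_sat_def by blast
  next
    assume "\<forall>a\<in>univ M. skolem_sat M (s(x \<mapsto> a)) (del x g)"
    then obtain G where G: "\<And>a. a \<in> univ M \<Longrightarrow> strategy M (G a)"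
      "\<And>a. a \<in> univ M \<Longrightarrow> skolem_holds M (G a) (s(x \<mapsto> a)) (del x g)"
      unfolding skolem_sat_def by metis
    obtain a0 where a0: "a0 \<in> univ M" using assms(4) by auto
    \<comment> \<open>The strategies chosen for the values of \<open>x\<close> are glued into one
      that reads this value off its argument. The default \<open>a0\<close> covers arguments where
      \<open>x\<close> is missing or lies outside the universe.\<close>
    define F where "F u t = (case t x of None \<Rightarrow> a0
      | Some a \<Rightarrow> if a \<in> univ M then G a u (t(x := None)) else a0)" for u t
    have "strategy M F" using G(1) a0 by (auto simp: strategy_def F_def split: option.splits)
    moreover have "(\<lambda>u t. F u (t(x \<mapsto> a))) = (\<lambda>u t. G a u (t(x := None)))" if "a \<in> univ M" for a
      using that by (intro ext) (simp add: F_def)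
    then have "skolem_holds M (\<lambda>u t. F u (t(x \<mapsto> a))) (s(x \<mapsto> a)) (del x g)" if "a \<in> univ M" for a
      using that G(2)[OF that] by (simp only: skolem_holds_del_ignores)
    then have "skolem_holds M F s g" using eq[of F] by blast
    ultimately show "skolem_sat M s g" unfolding skolem_sat_def by blast
  qed
qed

subsection \<open>Splitting at a connective\<close>

fun Alls :: "var list \<Rightarrow> ('f, 'r) dform \<Rightarrow> ('f, 'r) dform" where
  "Alls [] g = g"
| "Alls (x # xs) g = DAll x (Alls xs g)"

lemma Alls_decompose: "\<exists>xs h. g = Alls xs h \<and> (\<forall>x h'. h \<noteq> DAll x h')"
proof (induction g)
  case (DAll x g)
  then obtain xs h where "g = Alls xs h" "\<forall>x h'. h \<noteq> DAll x h'" by auto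
  then show ?case by (intro exI[of _ "x # xs"] exI[of _ h]) auto
qed (rule exI[of _ "[]"], auto)+

lemma exs_Alls: "exs P (Alls xs g) = exs (P \<union> set xs) g"
  by (induction xs arbitrary: P) auto

lemma coord_free_Alls: "coord_free P (Alls xs g) = coord_free (P \<union> set xs) g"
  by (induction xs arbitrary: P) auto

lemma bnd_Alls: "bnd (Alls xs g) = set xs \<union> bnd g"
  by (induction xs) auto

lemma free_Alls: "free (Alls xs g) = free g - set xs"
  by (induction xs) auto

lemma dsyms_Alls: "dsyms (Alls xs g) = dsyms g"
  by (induction xs) auto

lemma nodes_Alls: "nodes (Alls xs g) = length xs + nodes g"
  by (induction xs) auto

lemma apart_Alls: "apart (Alls xs g) \<longleftrightarrow> distinct xs \<and> set xs \<inter> bnd g = {} \<and> apart g"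
  by (induction xs) (auto simp: bnd_Alls)

lemma good_Alls_Conn:
  assumes "good (Alls xs (DConn c g h))"
  shows "good (Alls xs g)" and "good (Alls xs h)"
  using assms unfolding good_def
  by (auto simp: exs_Alls coord_free_Alls apart_Alls elim: henkin_free_mono)

lemma skolem_holds_Alls_Conj:
  "skolem_holds M F s (Alls xs (DConn Conj g h)) \<longleftrightarrow>
     skolem_holds M F s (Alls xs g) \<and> skolem_holds M F s (Alls xs h)"
  by (induction xs arbitrary: s) auto

text \<open>The Skolem functions of the two conjuncts carry disjoint sets of names, so two
  strategies combine into one; the shared prefix involves no Skolem function.\<close>

lemma skolem_sat_Alls_Conj:
  fixes g h :: "('f, 'r) dform"
  assumes "apart (Alls xs (DConn Conj g h))"
  shows "skolem_sat M s (Alls xs (DConn Conj g h)) \<longleftrightarrow> skolem_sat M s (Alls xs g) \<and> skolem_sat M s (Alls xs h)"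
proof
  assume "skolem_sat M s (Alls xs (DConn Conj g h))"
  then show "skolem_sat M s (Alls xs g) \<and> skolem_sat M s (Alls xs h)"
    unfolding skolem_sat_def skolem_holds_Alls_Conj by blast
next
  assume "skolem_sat M s (Alls xs g) \<and> skolem_sat M s (Alls xs h)"
  then obtain F G where F: "strategy M F" "skolem_holds M F s (Alls xs g)"
    and G: "strategy M G" "skolem_holds M G s (Alls xs h)"
    unfolding skolem_sat_def by blast
  let ?H = "\<lambda>u. if u \<in> bnd g then F u else G u"
  have "bnd g \<inter> bnd h = {}" using assms bnd_subset_occ[of h] by (auto simp: apart_Alls)
  then have "\<forall>u\<in>bnd h. ?H u = G u" by auto
  moreover have indep: "skolem_holds M F t (Alls xs k) \<longleftrightarrow> skolem_holds M F' t (Alls xs k)"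
    if "\<forall>u\<in>bnd k. F u = F' u" for F F' t and k :: "('f, 'r) dform"
    by (induction xs arbitrary: t) (simp_all add: skolem_holds_cong_strategy[OF that])
  ultimately have "skolem_holds M ?H s (Alls xs g)" "skolem_holds M ?H s (Alls xs h)"
    using F(2) G(2) indep[of g ?H F s] indep[of h ?H G s] by auto
  moreover have "strategy M ?H" using F(1) G(1) by (auto simp: strategy_def)
  ultimately show "skolem_sat M s (Alls xs (DConn Conj g h))"
    unfolding skolem_sat_def skolem_holds_Alls_Conj by blast
qed

text \<open>Without a universal prefix the disjunct is chosen once, so the existence of a strategy
  distributes over it. Behind a prefix the two disjuncts could be needed for different
  values.\<close>

lemma skolem_sat_Disj:
  assumes "univ M \<noteq> {}"
  shows "skolem_sat M s (DConn Disj g h) \<longleftrightarrow> skolem_sat M s g \<or> skolem_sat M s h"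
  unfolding skolem_sat_def skolem_holds.simps by blast

subsection \<open>Definability\<close>

lemma exs_superset: "(U, A) \<in> exs P g \<Longrightarrow> P \<subseteq> U"
  by (induction g arbitrary: P) auto

lemma finite_bnd: "finite (bnd g)"
  by (induction g) auto

text \<open>
  With \<open>A\<close> a smallest dependency set, any set not above \<open>A\<close> is incomparable to it. The Henkin
  condition excludes this when the first non-universal symbol is an existential quantifier, and
  together with the coordination condition it puts the whole universal prefix into every dependency
  set when that symbol is a disjunction.
\<close>

lemma common_dependency:
  assumes good: "good (Alls xs h)" and E: "E = exs {} (Alls xs h)" and "E \<noteq> {}"
    and nonempty: "\<And>U A. (U, A) \<in> E \<Longrightarrow> A \<noteq> {}"
    and shape: "(\<exists>g1 g2. h = DConn Disj g1 g2) \<and> xs \<noteq> [] \<or> (\<exists>u B g. h = DEx u B g)"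
  shows "\<exists>x. \<forall>(U, A)\<in>E. x \<in> A"
proof -
  have E': "E = exs (set xs) h" using E by (simp add: exs_Alls)
  have hf: "henkin_free E" using good E by (simp add: good_def)
  have fin: "finite A" if "(U, A) \<in> E" for U A
    using henkin_free_scope[OF hf that] exs_subset[of U A "{}" "Alls xs h"] that E finite_bnd[of "Alls xs h"]
    by (auto intro: finite_subset)
  obtain U A where A: "(U, A) \<in> E" and "\<forall>p\<in>E. card A \<le> card (snd p)"
    using ex_has_least_nat[of "\<lambda>p. p \<in> E" _ "\<lambda>p. card (snd p)"] \<open>E \<noteq> {}\<close> by (metis ex_in_conv prod.collapse)
  then have least: "A' = A" if "(U', A') \<in> E" "A' \<subseteq> A" for U' A'
    using that card_seteq[OF fin[OF A] that(2)] by force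
  have prefix: "set xs \<subseteq> U'" if "(U', A') \<in> E" for U' A' using that exs_superset E' by blast
  show ?thesis
  proof (cases "\<forall>(U', A')\<in>E. A \<subseteq> A'")
    case True
    then show ?thesis using nonempty[OF A] by fast
  next
    case False
    then obtain U' A' where A': "(U', A') \<in> E" "\<not> A \<subseteq> A'" by auto
    then have "\<not> A' \<subseteq> A" using least by blast
    from shape show ?thesis
    proof
      assume "(\<exists>g1 g2. h = DConn Disj g1 g2) \<and> xs \<noteq> []"
      then obtain g1 g2 x where h: "h = DConn Disj g1 g2" and x: "x \<in> set xs" by (cases xs) auto
      have "coord_free (set xs) h" using good by (simp add: good_def coord_free_Alls)
      then have "set xs \<subseteq> A \<union> A' \<or> A \<subseteq> A' \<or> A' \<subseteq> A"
        using A A'(1) unfolding h coord_free.simps E' by blast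
      then have "x \<in> A \<union> A'" using x A'(2) \<open>\<not> A' \<subseteq> A\<close> by blast
      \<comment> \<open>Were \<open>x\<close> in \<open>A'\<close> only, the Henkin condition with
        the roles exchanged would put \<open>A\<close> inside \<open>A'\<close>.\<close>
      then have "x \<in> A"
        using henkin_free_subset[OF hf A'(1) A, of x] A'(2) prefix[OF A] prefix[OF A'(1)] x by blast
      have "x \<in> B" if B: "(V, B) \<in> E" for V B
      proof (rule ccontr)
        assume "x \<notin> B"
        then have "B \<subseteq> A"
          using henkin_free_subset[OF hf A B, of x] \<open>x \<in> A\<close> prefix[OF A] prefix[OF B] x by blast
        then show False using least[OF B] \<open>x \<in> A\<close> \<open>x \<notin> B\<close> by blast
      qed
      then show ?thesis by blast
    next
      assume "\<exists>u B g. h = DEx u B g"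
      then obtain u B g where h: "h = DEx u B g" by auto
      then have B: "(set xs, B) \<in> E" unfolding E' by simp
      have Bxs: "B \<subseteq> set xs" using henkin_free_scope[OF hf B] .
      \<comment> \<open>Every element of \<open>B\<close> belongs to the leading universal prefix,
        hence lies above all existentials, so the scope hypothesis of the Henkin condition always
        holds.\<close>
      have cmp: "B \<subseteq> C \<or> C \<subseteq> B" if C: "(V, C) \<in> E" for V C
        using henkin_free_subset[OF hf B C] Bxs prefix[OF C] by blast
      have False
      proof (cases "B \<subseteq> A")
        case True
        then have "B = A" using least[OF B] by simp
        then show False using cmp[OF A'(1)] A'(2) \<open>\<not> A' \<subseteq> A\<close> by blast
      next
        case False
        then have "A \<subseteq> B" using cmp[OF A] by simp
        obtain y where "y \<in> A" "y \<notin> A'" using A'(2) by auto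
        then have "A' \<subseteq> A"
          using henkin_free_subset[OF hf A A'(1), of y] \<open>A \<subseteq> B\<close> Bxs prefix[OF A] prefix[OF A'(1)] by blast
        then show False using \<open>\<not> A' \<subseteq> A\<close> by simp
      qed
      then show ?thesis ..
    qed
  qed
qed

text \<open>The clause for \<open>DEx\<close> is a junk value, which ignores the dependency set.\<close>

fun fo_of :: "('f, 'r) dform \<Rightarrow> ('f, 'r) fo" where
  "fo_of (DLeaf \<phi>) = \<phi>"
| "fo_of (DConn Conj g h) = FAnd (fo_of g) (fo_of h)"
| "fo_of (DConn Disj g h) = FOr (fo_of g) (fo_of h)"
| "fo_of (DAll x g) = FAll x (fo_of g)"
| "fo_of (DEx u A g) = FEx u (fo_of g)"

lemma fo_FV_fo_of: "fo_FV (fo_of g) = free g"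
  by (induction g rule: fo_of.induct) auto

lemma fo_syms_fo_of: "fo_syms (fo_of g) = dsyms g"
  by (induction g rule: fo_of.induct) auto

lemma fo_of_no_exs: "exs P g = {} \<Longrightarrow> skolem_holds M F s g \<longleftrightarrow> fo_sat M s (fo_of g)"
  by (induction g arbitrary: P s rule: fo_of.induct) auto

definition fo_defines :: "'a itself \<Rightarrow> ('f, 'r) fo \<Rightarrow> ('f, 'r) dform \<Rightarrow> bool" where
  "fo_defines _ \<theta> g \<longleftrightarrow> fo_FV \<theta> \<subseteq> free g \<and> fo_syms \<theta> \<subseteq> dsyms g \<and>
     (\<forall>(M :: ('a, 'f, 'r) struct) s. univ M \<noteq> {} \<longrightarrow> (fo_sat M s \<theta> \<longleftrightarrow> skolem_sat M s g))"

text \<open>Each move deletes a bound variable and each splitting drops a connective and one branch,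
  so the number of nodes decreases although the universal prefix is copied.\<close>

lemma good_fo_definable:
  fixes g :: "('f, 'r) dform"
  shows "good g \<Longrightarrow> \<exists>\<theta>. fo_defines TYPE('a) \<theta> g"
proof (induction "nodes g" arbitrary: g rule: less_induct)
  case less
  note good = less.prems
  have apart: "apart g" and hf: "henkin_free (exs {} g)" using good by (auto simp: good_def)
  have IH: "\<exists>\<theta>. fo_defines TYPE('a) \<theta> (del x g)" if "x \<in> bnd g" for x
    by (rule less.hyps[OF nodes_del_less[OF that] good_del[OF good]])
  consider (none) "exs {} g = {}" | (empty) U where "(U, {}) \<in> exs {} g"
    | (common) x where "exs {} g \<noteq> {}" "\<forall>(U, A)\<in>exs {} g. x \<in> A"
    | (split) "exs {} g \<noteq> {}" "\<forall>U. (U, {}) \<notin> exs {} g" "\<nexists>x. \<forall>(U, A)\<in>exs {} g. x \<in> A"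
    by meson
  then show ?case
  proof cases
    case none
    have "fo_sat M s (fo_of g) \<longleftrightarrow> skolem_sat M s g" if univ: "univ M \<noteq> {}"
      for M :: "('a, 'f, 'r) struct" and s
    proof -
      obtain F where "strategy M F" using strategy_exists[OF univ] by (rule exE)
      then show ?thesis unfolding skolem_sat_def fo_of_no_exs[OF none] by auto
    qed
    then have "fo_defines TYPE('a) (fo_of g) g"
      by (simp add: fo_defines_def fo_FV_fo_of fo_syms_fo_of)
    then show ?thesis by (rule exI)
  next
    case empty
    obtain u where u: "u \<in> bnd g" and eq: "\<forall>(M :: ('a, 'f, 'r) struct) s.
        skolem_sat M s g \<longleftrightarrow> (\<exists>a\<in>univ M. skolem_sat M (s(u \<mapsto> a)) (del u g))"
      using skolem_sat_pull_ex[OF empty apart] by (rule bexE)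
    obtain \<theta> where \<theta>: "fo_defines TYPE('a) \<theta> (del u g)" using IH[OF u] by (rule exE)
    have "fo_FV \<theta> - {u} \<subseteq> free g" using \<theta> free_del[of u g] by (auto simp: fo_defines_def)
    then have "fo_defines TYPE('a) (FEx u \<theta>) g" using \<theta> eq by (simp add: fo_defines_def dsyms_del)
    then show ?thesis by (rule exI)
  next
    case common
    have dep: "\<forall>(U, A)\<in>exs {} g. A \<subseteq> U \<and> x \<in> A"
      using common(2) henkin_free_scope[OF hf] by (simp add: case_prod_beta')
    obtain U A where "(U, A) \<in> exs {} g" using common(1) by fast
    with dep have x: "x \<in> bnd g" using exs_subset[of U A "{}" g] by fastforce
    obtain \<theta> where \<theta>: "fo_defines TYPE('a) \<theta> (del x g)" using IH[OF x] by (rule exE)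
    have "fo_FV \<theta> - {x} \<subseteq> free g" using \<theta> free_del[of x g] by (auto simp: fo_defines_def)
    then have "fo_defines TYPE('a) (FAll x \<theta>) g"
      using \<theta> by (simp add: fo_defines_def dsyms_del skolem_sat_pull_all[OF dep x apart])
    then show ?thesis by (rule exI)
  next
    case split
    obtain xs h where g: "g = Alls xs h" and not_all: "\<forall>x h'. h \<noteq> DAll x h'"
      using Alls_decompose[of g] by (elim exE conjE)
    \<comment> \<open>In either of these shapes a common variable would exist, against the failure
      of the move for universal quantifiers. Only a conjunction, or a disjunction with empty prefix,
      remains.\<close>
    have "\<not> ((\<exists>g1 g2. h = DConn Disj g1 g2) \<and> xs \<noteq> [] \<or> (\<exists>u B g. h = DEx u B g))"
      using common_dependency[of xs h "exs {} g"] good split unfolding g by metis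
    moreover have "h \<noteq> DLeaf \<phi>" for \<phi> using split(1) by (auto simp: g exs_Alls)
    ultimately obtain c g1 g2 where h: "h = DConn c g1 g2" "c = Disj \<longrightarrow> xs = []"
      using not_all by (cases h) auto
    have "nodes (Alls xs g1) < nodes g" "nodes (Alls xs g2) < nodes g"
      unfolding g h(1) by (simp_all add: nodes_Alls)
    moreover have "good (Alls xs g1)" "good (Alls xs g2)" using good good_Alls_Conn unfolding g h(1) by blast+
    ultimately have IH: "\<exists>\<theta>. fo_defines TYPE('a) \<theta> (Alls xs g1)" "\<exists>\<theta>. fo_defines TYPE('a) \<theta> (Alls xs g2)"
      by (simp_all only: less.hyps)
    obtain \<theta>1 where 1: "fo_defines TYPE('a) \<theta>1 (Alls xs g1)" using IH(1) by (rule exE)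
    obtain \<theta>2 where 2: "fo_defines TYPE('a) \<theta>2 (Alls xs g2)" using IH(2) by (rule exE)
    show ?thesis
    proof (cases c)
      case Conj
      have "fo_defines TYPE('a) (FAnd \<theta>1 \<theta>2) g"
        using 1 2 apart unfolding g h(1) Conj
        by (auto simp: fo_defines_def free_Alls dsyms_Alls skolem_sat_Alls_Conj)
      then show ?thesis by (rule exI)
    next
      case Disj
      then have "fo_defines TYPE('a) (FOr \<theta>1 \<theta>2) g"
        using 1 2 h(2) unfolding g h(1)
        by (auto simp: fo_defines_def skolem_sat_Disj)
      then show ?thesis by (rule exI)
    qed
  qed
qed

section \<open>Translation of completed trees\<close>

text \<open>The heap numbering of the binary tree. Variables being natural numbers, each binder can
  be named by its position, which separates binders of the same variable in parallel
  branches.\<close>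

fun code :: "pos \<Rightarrow> var" where
  "code [] = 0"
| "code (Fst # p) = 2 * code p + 1"
| "code (Snd # p) = 2 * code p + 2"

lemma code_inj: "code p = code q \<Longrightarrow> p = q"
proof (induction p arbitrary: q rule: code.induct)
  case 1
  then show ?case by (cases q rule: code.cases) auto
next
  case (2 p)
  then show ?case by (cases q rule: code.cases) (auto, presburger)
next
  case (3 p)
  then show ?case by (cases q rule: code.cases) (auto, presburger)
qed

lemma code_eq_iff [simp]: "code p = code q \<longleftrightarrow> p = q"
  using code_inj by blast

lemma inj_code: "inj code"
  by (simp add: inj_def)

subsection \<open>Positions\<close>

lemma strict_prefix_snoc: "strict_prefix q (p @ [x]) \<longleftrightarrow> prefix q p"
  by (auto simp: strict_prefix_def prefix_snoc dest: prefix_length_le)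

text \<open>Dependence refers to positions in the whole tree, whereas the proofs recurse on
  subtrees; this relation carries labels and paths from one to the other.\<close>

definition subtree :: "itree \<Rightarrow> pos \<Rightarrow> itree \<Rightarrow> bool" where
  "subtree T p t \<longleftrightarrow> (\<forall>q. label_at T (p @ q) = label_at t q) \<and> (\<forall>P\<in>paths t. p @ P \<in> paths T)"

lemma subtree_root: "subtree T [] T"
  by (simp add: subtree_def)

lemma subtree_label: "subtree T p t \<Longrightarrow> label_at T p = label_at t []"
  unfolding subtree_def by (metis append_Nil2)

lemma subtree_Fst_TConn: "subtree T p (TConn c l r) \<Longrightarrow> subtree T (p @ [Fst]) l"
  unfolding subtree_def by force

lemma subtree_Snd_TConn: "subtree T p (TConn c l r) \<Longrightarrow> subtree T (p @ [Snd]) r"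
  unfolding subtree_def by force

lemma subtree_TQuant: "subtree T p (TQuant Q v V t) \<Longrightarrow> subtree T (p @ [Fst]) t"
  unfolding subtree_def by force

lemmas subtree_step = subtree_Fst_TConn subtree_Snd_TConn subtree_TQuant

lemma paths_nonempty: "paths T \<noteq> {}"
  by (induction T) auto

lemma prefix_of_path: "label_at T p \<noteq> None \<Longrightarrow> \<exists>P\<in>paths T. prefix p P"
proof (induction T p rule: label_at.induct)
  case (1 c l r)
  then show ?case using paths_nonempty[of "TConn c l r"] by auto
next
  case (4 Q v V t)
  then show ?case using paths_nonempty[of "TQuant Q v V t"] by auto
next
  case (2 c l r p)
  then obtain P where "P \<in> paths l" "prefix p P" by auto
  then show ?case by (auto intro!: bexI[of _ "Fst # P"])
next
  case (3 c l r p)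
  then obtain P where "P \<in> paths r" "prefix p P" by auto
  then show ?case by (auto intro!: bexI[of _ "Snd # P"])
qed auto

definition var_at :: "itree \<Rightarrow> pos \<Rightarrow> var option" where
  "var_at T p = (case label_at T p of Some (LQuant Q v V) \<Rightarrow> Some v | _ \<Rightarrow> None)"

lemma var_at_eq_Some: "var_at T p = Some v \<longleftrightarrow> (\<exists>Q V. label_at T p = Some (LQuant Q v V))"
  by (auto simp: var_at_def split: option.splits label.splits)

lemma var_at_tree_Bound: "var_at T p = Some v \<Longrightarrow> v \<in> tree_Bound T"
  unfolding var_at_eq_Some by (induction T p rule: label_at.induct) auto

lemma no_rebinding:
  "tree_no_requantification T \<Longrightarrow> strict_prefix q p \<Longrightarrow> var_at T q = Some v \<Longrightarrow> var_at T p \<noteq> Some v"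
proof (induction T q arbitrary: p rule: label_at.induct)
  case (4 Q w V t)
  then obtain x p' where p: "p = x # p'" by (cases p) auto
  have v: "w = v" using 4 by (simp add: var_at_def)
  show ?case
  proof
    assume *: "var_at (TQuant Q w V t) p = Some v"
    then have "x = Fst" using p by (cases x) (auto simp: var_at_def)
    then have "var_at t p' = Some v" using * p by (simp add: var_at_def)
    then show False using var_at_tree_Bound 4(1) v by fastforce
  qed
next
  case (2 c l r q)
  then obtain p' where "p = Fst # p'" "strict_prefix q p'" by (cases p) (auto simp: strict_prefix_def)
  then show ?case using 2 by (simp add: var_at_def)
next
  case (3 c l r q)
  then obtain p' where "p = Snd # p'" "strict_prefix q p'" by (cases p) (auto simp: strict_prefix_def)
  then show ?case using 3 by (simp add: var_at_def)
next
  case (5 Q w V t q)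
  then obtain p' where "p = Fst # p'" "strict_prefix q p'" by (cases p) (auto simp: strict_prefix_def)
  then show ?case using 5 by (simp add: var_at_def)
qed (auto simp: var_at_def)

text \<open>Two positions above \<open>p\<close> are comparable, so distinct binders of
  \<open>v\<close> there would be nested.\<close>

lemma unique_binder:
  assumes "tree_no_requantification T" "strict_prefix q p" "strict_prefix q' p"
    and "var_at T q = Some v" "var_at T q' = Some v"
  shows "q' = q"
proof -
  have "prefix q q' \<or> prefix q' q" using assms(2,3) by (metis prefix_same_cases strict_prefix_def)
  then show ?thesis using no_rebinding[OF assms(1)] assms(4,5) by (metis strict_prefixI)
qed

subsection \<open>Renaming variables apart\<close>

fun rename_trm :: "(var \<Rightarrow> var) \<Rightarrow> 'f trm \<Rightarrow> 'f trm" where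
  "rename_trm \<rho> (Var x) = Var (\<rho> x)"
| "rename_trm \<rho> (Fun f ts) = Fun f (map (rename_trm \<rho>) ts)"

fun rename_atom :: "(var \<Rightarrow> var) \<Rightarrow> ('f, 'r) atom \<Rightarrow> ('f, 'r) atom" where
  "rename_atom \<rho> (Equal t u) = Equal (rename_trm \<rho> t) (rename_trm \<rho> u)"
| "rename_atom \<rho> (Rel r ts) = Rel r (map (rename_trm \<rho>) ts)"

text \<open>Only meant for quantifier-free formulas; the value at a quantifier is irrelevant.\<close>

fun rename_qf :: "(var \<Rightarrow> var) \<Rightarrow> ('f, 'r) ifml \<Rightarrow> ('f, 'r) fo" where
  "rename_qf \<rho> (Pos a) = FAtom (rename_atom \<rho> a)"
| "rename_qf \<rho> (Neg a) = FNot (FAtom (rename_atom \<rho> a))"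
| "rename_qf \<rho> (Conn Conj \<phi> \<psi>) = FAnd (rename_qf \<rho> \<phi>) (rename_qf \<rho> \<psi>)"
| "rename_qf \<rho> (Conn Disj \<phi> \<psi>) = FOr (rename_qf \<rho> \<phi>) (rename_qf \<rho> \<psi>)"
| "rename_qf \<rho> (Quant Q v V \<phi>) = rename_qf \<rho> \<phi>"

lemma trm_vars_rename: "trm_vars (rename_trm \<rho> t) = \<rho> ` trm_vars t"
  by (induction t) auto

lemma trm_syms_rename: "trm_syms (rename_trm \<rho> t) = trm_syms t"
  by (induction t) auto

lemma atom_vars_rename: "atom_vars (rename_atom \<rho> a) = \<rho> ` atom_vars a"
  by (cases a) (auto simp: trm_vars_rename)

lemma atom_syms_rename: "atom_syms (rename_atom \<rho> a) = atom_syms a"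
  by (cases a) (auto simp: trm_syms_rename)

lemma fo_FV_rename: "quantifier_free \<phi> \<Longrightarrow> fo_FV (rename_qf \<rho> \<phi>) = \<rho> ` FV \<phi>"
  by (induction \<rho> \<phi> rule: rename_qf.induct) (auto simp: atom_vars_rename)

lemma fo_syms_rename: "fo_syms (rename_qf \<rho> \<phi>) = syms \<phi>"
  by (induction \<rho> \<phi> rule: rename_qf.induct) (auto simp: atom_syms_rename)

lemma trm_val_rename:
  "\<forall>v\<in>trm_vars t. r (\<rho> v) = s v \<Longrightarrow> trm_val M r (rename_trm \<rho> t) = trm_val M s t"
proof (induction t)
  case (Fun f ts)
  then have "map (trm_val M r) (map (rename_trm \<rho>) ts) = map (trm_val M s) ts" by auto
  then show ?case by (simp only: rename_trm.simps trm_val.simps)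
qed simp

lemma atom_holds_rename:
  assumes "\<forall>v\<in>atom_vars a. r (\<rho> v) = s v"
  shows "atom_holds M r (rename_atom \<rho> a) \<longleftrightarrow> atom_holds M s a"
proof (cases a)
  case (Equal t u)
  have "trm_val M r (rename_trm \<rho> t) = trm_val M s t" "trm_val M r (rename_trm \<rho> u) = trm_val M s u"
    using assms Equal by (auto intro!: trm_val_rename)
  then show ?thesis using Equal by simp
next
  case (Rel R ts)
  have "map (trm_val M r) (map (rename_trm \<rho>) ts) = map (trm_val M s) ts"
    using assms Rel by (auto intro!: trm_val_rename)
  then show ?thesis by (simp only: Rel rename_atom.simps atom_holds.simps)
qed

lemma fo_sat_rename:
  "quantifier_free \<phi> \<Longrightarrow> \<forall>v\<in>FV \<phi>. r (\<rho> v) = s v \<Longrightarrow>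
     fo_sat M r (rename_qf \<rho> \<phi>) \<longleftrightarrow> fo_sat M s (erase_slashes \<phi>)"
  by (induction \<rho> \<phi> rule: rename_qf.induct) (auto simp: atom_holds_rename)

definition binder_var :: "itree \<Rightarrow> pos \<Rightarrow> var \<Rightarrow> var" where
  "binder_var T p v = code (THE q. strict_prefix q p \<and> var_at T q = Some v)"

text \<open>Existential variables outside the slash set are left out: in a non-signalling tree their
  values on the relevant teams are functions of universal variables that are already
  included.\<close>

definition dep_vars :: "itree \<Rightarrow> pos \<Rightarrow> var set" where
  "dep_vars T p = code ` {q. quant_at T Forall q \<and> depends T p q}"

fun translate :: "itree \<Rightarrow> (pos \<Rightarrow> ('f, 'r) ifml) \<Rightarrow> pos \<Rightarrow> itree \<Rightarrow> ('f, 'r) dform" where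
  "translate T e p Gap = DLeaf (rename_qf (binder_var T p) (e p))"
| "translate T e p (TConn c l r) = DConn c (translate T e (p @ [Fst]) l) (translate T e (p @ [Snd]) r)"
| "translate T e p (TQuant Forall v V t) = DAll (code p) (translate T e (p @ [Fst]) t)"
| "translate T e p (TQuant Exists v V t) = DEx (code p) (dep_vars T p) (translate T e (p @ [Fst]) t)"

text \<open>The name of a binder strictly above \<open>p\<close> receives the value of the variable
  bound there; all other names stay undefined, so the renamed assignment matches what
  \<open>translate\<close> has assigned on the way to \<open>p\<close>.\<close>

definition rename_assignment :: "itree \<Rightarrow> pos \<Rightarrow> 'a assignment \<Rightarrow> 'a assignment" where
  "rename_assignment T p s n =
     (if n \<in> code ` {q. strict_prefix q p} then Option.bind (var_at T (inv code n)) s else None)"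

lemma rename_assignment_code:
  "rename_assignment T p s (code q) = (if strict_prefix q p then Option.bind (var_at T q) s else None)"
  by (auto simp: rename_assignment_def inv_f_f[OF inj_code])

lemma rename_assignment_None: "n \<notin> range code \<Longrightarrow> rename_assignment T p s n = None"
  by (auto simp: rename_assignment_def)

lemma rename_assignment_root: "rename_assignment T [] s = Map.empty"
  by (auto simp: rename_assignment_def fun_eq_iff)

lemma rename_assignment_conn:
  assumes "label_at T p = Some (LConn c)"
  shows "rename_assignment T (p @ [x]) s = rename_assignment T p s"
proof
  fix n show "rename_assignment T (p @ [x]) s n = rename_assignment T p s n"
  proof (cases "n \<in> range code")
    case True
    then obtain q where n: "n = code q" by auto
    have "var_at T p = None" using assms by (simp add: var_at_def)
    then show ?thesis unfolding n rename_assignment_code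
      by (auto simp: strict_prefix_snoc strict_prefix_def)
  qed (simp add: rename_assignment_None)
qed

text \<open>Overwriting \<open>v\<close> leaves the earlier entries intact because no quantifier
  above \<open>p\<close> binds \<open>v\<close>.\<close>

lemma rename_assignment_quant:
  assumes "tree_no_requantification T" and v: "var_at T p = Some v"
  shows "rename_assignment T (p @ [x]) (s(v \<mapsto> a)) = (rename_assignment T p s)(code p \<mapsto> a)"
proof
  fix n show "rename_assignment T (p @ [x]) (s(v \<mapsto> a)) n = ((rename_assignment T p s)(code p \<mapsto> a)) n"
  proof (cases "n \<in> range code")
    case True
    then obtain q where n: "n = code q" by auto
    show ?thesis
    proof (cases "strict_prefix q p")
      case True
      then have "var_at T q \<noteq> Some v" "q \<noteq> p" "prefix q p"
        using no_rebinding[OF assms(1) True] v by (auto simp: strict_prefix_def)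
      then show ?thesis using True unfolding n
        by (cases "var_at T q") (auto simp: rename_assignment_code strict_prefix_snoc)
    next
      case False
      then show ?thesis unfolding n using v
        by (auto simp: rename_assignment_code strict_prefix_snoc strict_prefix_def)
    qed
  next
    case False
    then show ?thesis by (auto simp: rename_assignment_None)
  qed
qed

lemma rename_assignment_binder_var:
  assumes "tree_no_requantification T" and "strict_prefix q p" and "var_at T q = Some v"
  shows "binder_var T p v = code q" and "rename_assignment T p s (binder_var T p v) = s v"
proof -
  have "(THE q. strict_prefix q p \<and> var_at T q = Some v) = q"
    using assms unique_binder[OF assms(1)] by (intro the_equality) blast+
  then show "binder_var T p v = code q" by (simp add: binder_var_def)
  then show "rename_assignment T p s (binder_var T p v) = s v"
    using assms by (simp add: rename_assignment_code)
qed

text \<open>A gap carries no label, so the binder provided by a sentential completion lies strictly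
  above it.\<close>

lemma gap_binders:
  assumes "sentential T e" and "subtree T p Gap" and "v \<in> FV (e p)"
  shows "\<exists>q. strict_prefix q p \<and> var_at T q = Some v"
proof -
  have "p \<in> paths T" using assms(2) unfolding subtree_def by force
  then have "v \<in> path_Bound T p" using assms(1,3) by (auto simp: sentential_def)
  then obtain q Q V where q: "prefix q p" "label_at T q = Some (LQuant Q v V)"
    by (auto simp: path_Bound_def)
  moreover have "label_at T p = None" using subtree_label[OF assms(2)] by simp
  ultimately have "strict_prefix q p" by (auto simp: strict_prefix_def)
  then show ?thesis using q(2) by (auto simp: var_at_eq_Some)
qed

subsection \<open>Team semantics and Skolem functions\<close>

text \<open>The invariant that non-signalling trees preserve along a path.\<close>

definition determined :: "itree \<Rightarrow> pos \<Rightarrow> 'a assignment set \<Rightarrow> bool" where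
  "determined T p X \<longleftrightarrow>
     (\<forall>s\<in>X. \<forall>w. (\<forall>q. strict_prefix q p \<longrightarrow> var_at T q \<noteq> Some w) \<longrightarrow> s w = None) \<and>
     (\<forall>q. strict_prefix q p \<longrightarrow> quant_at T Exists q \<longrightarrow> (\<forall>s\<in>X. \<forall>s'\<in>X.
        rename_assignment T p s |` dep_vars T q = rename_assignment T p s' |` dep_vars T q \<longrightarrow>
        rename_assignment T p s (code q) = rename_assignment T p s' (code q)))"

lemma determined_subset: "determined T p X \<Longrightarrow> Y \<subseteq> X \<Longrightarrow> determined T p Y"
  unfolding determined_def by (meson subsetD)

lemma determined_conn:
  assumes "determined T p X" and label: "label_at T p = Some (LConn c)"
  shows "determined T (p @ [x]) X"
proof -
  have "\<not> quant_at T Exists p" "var_at T p = None" using label by (auto simp: quant_at_def var_at_def)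
  then have "strict_prefix q (p @ [x]) \<and> quant_at T Exists q \<longleftrightarrow> strict_prefix q p \<and> quant_at T Exists q"
    and "strict_prefix q (p @ [x]) \<and> var_at T q = Some w \<longleftrightarrow> strict_prefix q p \<and> var_at T q = Some w" for q w
    by (auto simp: strict_prefix_snoc strict_prefix_def)
  then show ?thesis using assms(1) unfolding determined_def rename_assignment_conn[OF label] by metis
qed

lemma dep_vars_above: "code q \<in> dep_vars T p \<Longrightarrow> strict_prefix q p"
  by (auto simp: dep_vars_def depends_def)

text \<open>Dependency sets of quantifiers at or above \<open>p\<close> contain only positions
  strictly above them, so the new variable does not disturb them. Only the quantifier at
  \<open>p\<close> itself, if existential, needs the extra hypothesis.\<close>

lemma determined_quant:
  assumes "tree_no_requantification T" and det: "determined T p X" and v: "var_at T p = Some v"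
    and X': "\<And>s'. s' \<in> X' \<Longrightarrow> \<exists>s\<in>X. \<exists>a. s' = s(v \<mapsto> a)"
    and new: "\<And>s s' a a'. quant_at T Exists p \<Longrightarrow> s \<in> X \<Longrightarrow> s' \<in> X \<Longrightarrow> s(v \<mapsto> a) \<in> X' \<Longrightarrow> s'(v \<mapsto> a') \<in> X' \<Longrightarrow>
      rename_assignment T p s |` dep_vars T p = rename_assignment T p s' |` dep_vars T p \<Longrightarrow> a = a'"
  shows "determined T (p @ [x]) X'"
  unfolding determined_def
proof (intro conjI ballI allI impI)
  fix s' w assume s': "s' \<in> X'" and w: "\<forall>q. strict_prefix q (p @ [x]) \<longrightarrow> var_at T q \<noteq> Some w"
  obtain s a where s: "s \<in> X" "s' = s(v \<mapsto> a)" using X'[OF s'] by blast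
  have "w \<noteq> v" using w v by (auto simp: strict_prefix_snoc)
  moreover have "\<forall>q. strict_prefix q p \<longrightarrow> var_at T q \<noteq> Some w" using w by (auto simp: strict_prefix_snoc dest: prefix_order.less_imp_le)
  then have "s w = None" using det s(1) unfolding determined_def by blast
  ultimately show "s' w = None" using s by simp
next
  fix q t t' assume q: "strict_prefix q (p @ [x])" "quant_at T Exists q" and t: "t \<in> X'" "t' \<in> X'"
    and eq: "rename_assignment T (p @ [x]) t |` dep_vars T q = rename_assignment T (p @ [x]) t' |` dep_vars T q"
  obtain s a where s: "s \<in> X" "t = s(v \<mapsto> a)" using X'[OF t(1)] by blast
  obtain s' a' where s': "s' \<in> X" "t' = s'(v \<mapsto> a')" using X'[OF t(2)] by blast
  have ren: "rename_assignment T (p @ [x]) t = (rename_assignment T p s)(code p \<mapsto> a)"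
     "rename_assignment T (p @ [x]) t' = (rename_assignment T p s')(code p \<mapsto> a')"
    unfolding s s' by (rule rename_assignment_quant[OF assms(1) v])+
  have "prefix q p" using q(1) by (simp add: strict_prefix_snoc)
  then have "code p \<notin> dep_vars T q" using dep_vars_above[of p T q] by (auto simp: strict_prefix_def dest: prefix_order.antisym)
  then have eq': "rename_assignment T p s |` dep_vars T q = rename_assignment T p s' |` dep_vars T q"
    using eq unfolding ren by simp
  show "rename_assignment T (p @ [x]) t (code q) = rename_assignment T (p @ [x]) t' (code q)"
  proof (cases "q = p")
    case True
    then have "a = a'" using new[of s s' a a'] q(2) s s' t eq' by simp
    then show ?thesis unfolding ren True by simp
  next
    case False
    then have "strict_prefix q p" using \<open>prefix q p\<close> by (simp add: strict_prefix_def)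
    then have "rename_assignment T p s (code q) = rename_assignment T p s' (code q)"
      using det q(2) s(1) s'(1) eq' unfolding determined_def by blast
    then show ?thesis unfolding ren using False by simp
  qed
qed

text \<open>Dependence on a universal quantifier passes through an intermediate existential one. The
  three quantifiers share a path, since dependence implies scope.\<close>

lemma not_signallingD:
  assumes "\<not> signalling T" and "quant_at T Forall x" "quant_at T Exists y" "quant_at T Exists z"
    and "depends T y x" "depends T z y"
  shows "depends T z x"
proof (rule ccontr)
  assume "\<not> depends T z x"
  have "label_at T z \<noteq> None" using assms(4) by (auto simp: quant_at_def)
  then obtain P where P: "P \<in> paths T" "prefix z P" using prefix_of_path by blast
  have "prefix y z" "prefix x y" using assms(5,6) by (auto simp: depends_def strict_prefix_def)
  then have "prefix y P" "prefix x P" using P(2) by (auto intro: prefix_order.trans)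
  then have "signalling_path T P"
    unfolding signalling_path_def using assms \<open>\<not> depends T z x\<close> P(2)
    by (intro exI[of _ x] exI[of _ y] exI[of _ z]) simp
  then show False using P(1) assms(1) by (auto simp: signalling_def)
qed

text \<open>
  Universal variables outside the slash set belong to the dependency set, and existential ones are,
  since the tree is not signalling, functions of part of it.
\<close>

lemma agreement_outside_slash_set:
  assumes "\<not> signalling T" and "tree_no_requantification T" and det: "determined T p X"
    and label: "label_at T p = Some (LQuant Exists v V)"
    and s: "s \<in> X" "s' \<in> X" and w: "w \<notin> fset V"
    and eq: "rename_assignment T p s |` dep_vars T p = rename_assignment T p s' |` dep_vars T p"
  shows "s w = s' w"
proof (cases "\<exists>q. strict_prefix q p \<and> var_at T q = Some w")
  case False
  then have "s w = None" "s' w = None" using det s unfolding determined_def by blast+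
  then show ?thesis by simp
next
  case True
  then obtain q where q: "strict_prefix q p" "var_at T q = Some w" by blast
  then obtain Q W where Q: "label_at T q = Some (LQuant Q w W)" by (auto simp: var_at_eq_Some)
  have val: "t w = rename_assignment T p t (code q)" for t :: "'a assignment"
    using q by (simp add: rename_assignment_code)
  have dep: "depends T p q" using q(1) label Q w by (auto simp: depends_def)
  show ?thesis
  proof (cases Q)
    case Forall
    then have "code q \<in> dep_vars T p" using dep Q by (auto simp: dep_vars_def quant_at_def)
    then show ?thesis using fun_cong[OF eq, of "code q"] unfolding val by simp
  next
    case Exists
    then have ex: "quant_at T Exists q" using Q by (auto simp: quant_at_def)
    have "quant_at T Exists p" using label by (auto simp: quant_at_def)
    \<comment> \<open>Non-signalling enters here: everything that determines the value at
      \<open>q\<close> is also available at \<open>p\<close>.\<close>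
    then have "dep_vars T q \<subseteq> dep_vars T p"
      using not_signallingD[OF assms(1) _ ex _ _ dep] unfolding dep_vars_def by blast
    then have "rename_assignment T p t |` dep_vars T q =
        (rename_assignment T p t |` dep_vars T p) |` dep_vars T q" for t :: "'a assignment"
      by (simp add: Int_absorb1)
    then have "rename_assignment T p s |` dep_vars T q = rename_assignment T p s' |` dep_vars T q"
      by (simp only: eq)
    then show ?thesis using det q(1) ex s unfolding val determined_def by blast
  qed
qed

section \<open>Merging strategies and extending teams\<close>

lemma bnd_translate: "bnd (translate T e p t) \<subseteq> code ` {q. prefix p q}"
proof (induction t arbitrary: p)
  case (TConn c l r)
  have "code ` {q. prefix (p @ [x]) q} \<subseteq> code ` {q. prefix p q}" for x
    by (intro image_mono) (auto dest: append_prefixD)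
  then show ?case unfolding translate.simps bnd.simps using TConn.IH by (meson Un_least subset_trans)
next
  case (TQuant Q v V t)
  have "code ` {q. prefix (p @ [Fst]) q} \<subseteq> code ` {q. prefix p q}"
    by (intro image_mono) (auto dest: append_prefixD)
  moreover have "bnd (translate T e p (TQuant Q v V t)) = insert (code p) (bnd (translate T e (p @ [Fst]) t))"
    by (cases Q) auto
  ultimately show ?case using TQuant.IH[of "p @ [Fst]"] by simp
qed simp

lemma skolem_holds_merge:
  assumes F: "strategy M F" "\<forall>r\<in>R. skolem_holds M F r g"
    and G: "strategy M G" "\<forall>r\<in>S. skolem_holds M G r h" and disj: "bnd g \<inter> bnd h = {}"
  shows "\<exists>H. strategy M H \<and> (\<forall>r\<in>R. skolem_holds M H r g) \<and> (\<forall>r\<in>S. skolem_holds M H r h)"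
proof -
  let ?H = "\<lambda>u. if u \<in> bnd g then F u else G u"
  have "strategy M ?H" using F(1) G(1) by (simp add: strategy_def)
  moreover have "skolem_holds M ?H r g \<longleftrightarrow> skolem_holds M F r g" for r
    by (rule skolem_holds_cong_strategy) simp
  moreover have "skolem_holds M ?H r h \<longleftrightarrow> skolem_holds M G r h" for r
    by (rule skolem_holds_cong_strategy) (use disj in auto)
  ultimately show ?thesis using F(2) G(2) by (intro exI[of _ ?H]) simp
qed

lemma bnd_translate_siblings:
  "bnd (translate T e (p @ [Fst]) l) \<inter> bnd (translate T e (p @ [Snd]) r) = {}"
proof -
  have False if "prefix (p @ [Fst]) q" "prefix (p @ [Snd]) q" for q
    using that by (auto simp: prefix_def)
  then show ?thesis using bnd_translate[of T e "p @ [Fst]" l] bnd_translate[of T e "p @ [Snd]" r] by fastforce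
qed

lemma bnd_translate_below: "code p \<notin> bnd (translate T e (p @ [x]) t)"
  using bnd_translate[of T e "p @ [x]" t] by (auto dest: prefix_length_le)

lemma determined_duplicate:
  assumes "tree_no_requantification T" and "determined T p X" and "label_at T p = Some (LQuant Forall v V)"
  shows "determined T (p @ [x]) (duplicate_team X A v)"
  by (rule determined_quant[OF assms(1,2), of v])
    (use assms(3) in \<open>auto simp: duplicate_team_def var_at_def quant_at_def\<close>)

lemma determined_supplement:
  assumes "tree_no_requantification T" and "determined T p X" and label: "label_at T p = Some (LQuant Exists v V)"
    and F: "\<And>s s'. s \<in> X \<Longrightarrow> s' \<in> X \<Longrightarrow>
      rename_assignment T p s |` dep_vars T p = rename_assignment T p s' |` dep_vars T p \<Longrightarrow> F s = F s'"
  shows "determined T (p @ [x]) (supplement_team X F v)"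
proof (rule determined_quant[OF assms(1,2), of v])
  show v: "var_at T p = Some v" using label by (simp add: var_at_def)
  fix s' assume "s' \<in> supplement_team X F v"
  then show "\<exists>s\<in>X. \<exists>a. s' = s(v \<mapsto> a)" by (auto simp: supplement_team_def)
next
  \<comment> \<open>Since \<open>v\<close> is still unassigned, an assignment can be recovered from
    its extension, so the value added to it must be the one that \<open>F\<close> gives.\<close>
  have unbound: "s v = None" if "s \<in> X" for s
  proof -
    have "\<forall>q. strict_prefix q p \<longrightarrow> var_at T q \<noteq> Some v"
      using no_rebinding[OF assms(1)] label by (auto simp: var_at_eq_Some)
    then show ?thesis using assms(2) that unfolding determined_def by blast
  qed
  have val: "F s = a" if s: "s \<in> X" "s(v \<mapsto> a) \<in> supplement_team X F v" for s a
  proof -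
    obtain t where t: "t \<in> X" "s(v \<mapsto> a) = t(v \<mapsto> F t)" using s(2) by (auto simp: supplement_team_def)
    have "s = (s(v \<mapsto> a))(v := None)" using unbound[OF s(1)] by auto
    also have "\<dots> = t" unfolding t(2) using unbound[OF t(1)] by auto
    finally have "s = t" .
    then show ?thesis using fun_cong[OF t(2), of v] by simp
  qed
  fix s s' a a' assume "s \<in> X" "s' \<in> X" "s(v \<mapsto> a) \<in> supplement_team X F v" "s'(v \<mapsto> a') \<in> supplement_team X F v"
    "rename_assignment T p s |` dep_vars T p = rename_assignment T p s' |` dep_vars T p"
  then show "a = a'" using F val by metis
qed

text \<open>Every name in the dependency set stands for a variable outside the slash set, so
  assignments that agree outside it agree on all arguments of \<open>f\<close>.\<close>

lemma uniform_if_dependent: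
  assumes "tree_no_requantification T" and label: "label_at T p = Some (LQuant Exists v V)"
  shows "uniform_on (fset V) X (\<lambda>s. f (rename_assignment T p s |` dep_vars T p))"
  unfolding uniform_on_def
proof (intro ballI impI)
  fix s s' :: "'a assignment" assume eq: "\<forall>w. w \<notin> fset V \<longrightarrow> s w = s' w"
  have "rename_assignment T p s n = rename_assignment T p s' n" if n: "n \<in> dep_vars T p" for n
  proof -
    obtain q Q w W where q: "n = code q" "label_at T q = Some (LQuant Q w W)" "strict_prefix q p" "w |\<notin>| V"
      using n label by (auto simp: dep_vars_def depends_def)
    then show ?thesis using eq by (simp add: rename_assignment_code var_at_def)
  qed
  then have "rename_assignment T p s |` dep_vars T p = rename_assignment T p s' |` dep_vars T p"
    by (auto simp: restrict_map_def)
  then show "f (rename_assignment T p s |` dep_vars T p) = f (rename_assignment T p s' |` dep_vars T p)"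
    by simp
qed

lemma ball_duplicate_team: "(\<forall>s\<in>duplicate_team X A v. P s) \<longleftrightarrow> (\<forall>s\<in>X. \<forall>a\<in>A. P (s(v \<mapsto> a)))"
  unfolding duplicate_team_def by blast

text \<open>One strategy has to serve all assignments of the team. At an existential quantifier a
  uniform choice factors through the dependency set because the team is determined; conversely any
  function of that set is uniform.\<close>

lemma team_sat_iff_skolem:
  fixes e :: "pos \<Rightarrow> ('f, 'r) ifml"
  assumes nonsig: "\<not> signalling T" and noreq: "tree_no_requantification T"
    and "weak T e" "sentential T e" and univ: "univ M \<noteq> {}"
    and "subtree T p t" "determined T p X"
  shows "team_sat M X (fill_gaps t (\<lambda>P. e (p @ P))) \<longleftrightarrow>
    (\<exists>F. strategy M F \<and> (\<forall>s\<in>X. skolem_holds M F (rename_assignment T p s) (translate T e p t)))"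
  using assms(6,7)
proof (induction t arbitrary: p X)
  case Gap
  have "p \<in> paths T" using Gap.prems(1) unfolding subtree_def by force
  then have qf: "quantifier_free (e p)" using assms(3) by (simp add: weak_def)
  have "fo_sat M (rename_assignment T p s) (rename_qf (binder_var T p) (e p)) \<longleftrightarrow> fo_sat M s (erase_slashes (e p))" for s
  proof (rule fo_sat_rename[OF qf], rule ballI)
    fix v assume "v \<in> FV (e p)"
    then obtain q where "strict_prefix q p" "var_at T q = Some v" using gap_binders[OF assms(4) Gap.prems(1)] by blast
    then show "rename_assignment T p s (binder_var T p v) = s v" by (rule rename_assignment_binder_var(2)[OF noreq])
  qed
  then show ?case using strategy_exists[OF univ] by (simp add: team_sat_quantifier_free[OF qf])
next
  case (TConn c l r)
  have label: "label_at T p = Some (LConn c)" using subtree_label[OF TConn.prems(1)] by simp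
  have sub: "subtree T (p @ [Fst]) l" "subtree T (p @ [Snd]) r" using TConn.prems(1) subtree_step by blast+
  have IHl: "team_sat M Y (fill_gaps l (\<lambda>P. e (p @ Fst # P))) \<longleftrightarrow>
      (\<exists>F. strategy M F \<and> (\<forall>r\<in>rename_assignment T p ` Y. skolem_holds M F r (translate T e (p @ [Fst]) l)))"
    if "Y \<subseteq> X" for Y
    using TConn.IH(1)[OF sub(1) determined_conn[OF determined_subset[OF TConn.prems(2) that] label]]
    by (simp add: rename_assignment_conn[OF label])
  have IHr: "team_sat M Y (fill_gaps r (\<lambda>P. e (p @ Snd # P))) \<longleftrightarrow>
      (\<exists>F. strategy M F \<and> (\<forall>s\<in>rename_assignment T p ` Y. skolem_holds M F s (translate T e (p @ [Snd]) r)))"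
    if "Y \<subseteq> X" for Y
    using TConn.IH(2)[OF sub(2) determined_conn[OF determined_subset[OF TConn.prems(2) that] label]]
    by (simp add: rename_assignment_conn[OF label])
  let ?l = "translate T e (p @ [Fst]) l" and ?r = "translate T e (p @ [Snd]) r"
  show ?case
  proof (cases c)
    case Conj
    have "team_sat M X (fill_gaps (TConn c l r) (\<lambda>P. e (p @ P))) \<longleftrightarrow>
      (\<exists>F. strategy M F \<and> (\<forall>s\<in>rename_assignment T p ` X. skolem_holds M F s ?l)) \<and>
      (\<exists>F. strategy M F \<and> (\<forall>s\<in>rename_assignment T p ` X. skolem_holds M F s ?r))"
      unfolding Conj fill_gaps.simps team_sat.simps IHl[OF subset_refl] IHr[OF subset_refl] ..
    also have "\<dots> \<longleftrightarrow> (\<exists>F. strategy M F \<and> (\<forall>s\<in>rename_assignment T p ` X. skolem_holds M F s ?l) \<and>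
      (\<forall>s\<in>rename_assignment T p ` X. skolem_holds M F s ?r))" (is "?A \<longleftrightarrow> ?B")
    proof
      assume ?A
      then show ?B using skolem_holds_merge[OF _ _ _ _ bnd_translate_siblings] by (elim conjE exE)
    qed blast
    also have "\<dots> \<longleftrightarrow> (\<exists>F. strategy M F \<and>
      (\<forall>s\<in>X. skolem_holds M F (rename_assignment T p s) (translate T e p (TConn c l r))))"
      by (simp add: Conj ball_conj_distrib)
    finally show ?thesis .
  next
    case Disj
    have split: "X = Y \<union> Z \<and> team_sat M Y (fill_gaps l (\<lambda>P. e (p @ Fst # P))) \<and> team_sat M Z (fill_gaps r (\<lambda>P. e (p @ Snd # P))) \<longleftrightarrow>
      X = Y \<union> Z \<and> (\<exists>F. strategy M F \<and> (\<forall>s\<in>rename_assignment T p ` Y. skolem_holds M F s ?l)) \<and>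
      (\<exists>F. strategy M F \<and> (\<forall>s\<in>rename_assignment T p ` Z. skolem_holds M F s ?r))" for Y Z
    proof (rule conj_cong[OF refl])
      assume "X = Y \<union> Z"
      then have "Y \<subseteq> X" "Z \<subseteq> X" by auto
      from IHl[OF this(1)] IHr[OF this(2)]
      show "team_sat M Y (fill_gaps l (\<lambda>P. e (p @ Fst # P))) \<and> team_sat M Z (fill_gaps r (\<lambda>P. e (p @ Snd # P))) \<longleftrightarrow>
        (\<exists>F. strategy M F \<and> (\<forall>s\<in>rename_assignment T p ` Y. skolem_holds M F s ?l)) \<and>
        (\<exists>F. strategy M F \<and> (\<forall>s\<in>rename_assignment T p ` Z. skolem_holds M F s ?r))" by (simp only:)
    qed
    have "team_sat M X (fill_gaps (TConn c l r) (\<lambda>P. e (p @ P))) \<longleftrightarrow>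
      (\<exists>Y Z. X = Y \<union> Z \<and> (\<exists>F. strategy M F \<and> (\<forall>s\<in>rename_assignment T p ` Y. skolem_holds M F s ?l)) \<and>
      (\<exists>F. strategy M F \<and> (\<forall>s\<in>rename_assignment T p ` Z. skolem_holds M F s ?r)))"
      unfolding Disj fill_gaps.simps team_sat.simps split ..
    also have "\<dots> \<longleftrightarrow> (\<exists>F. strategy M F \<and>
      (\<forall>s\<in>X. skolem_holds M F (rename_assignment T p s) (translate T e p (TConn c l r))))" (is "?A \<longleftrightarrow> ?B")
    proof
      assume ?A
      then obtain Y Z F G where X: "X = Y \<union> Z"
        and F: "strategy M F" "\<forall>s\<in>rename_assignment T p ` Y. skolem_holds M F s ?l"
        and G: "strategy M G" "\<forall>s\<in>rename_assignment T p ` Z. skolem_holds M G s ?r" by (elim exE conjE)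
      obtain H where H: "strategy M H" "\<forall>s\<in>rename_assignment T p ` Y. skolem_holds M H s ?l"
        "\<forall>s\<in>rename_assignment T p ` Z. skolem_holds M H s ?r"
        using skolem_holds_merge[OF F G bnd_translate_siblings] by (elim exE conjE)
      show ?B by (rule exI[of _ H]) (use H X Disj in auto)
    next
      assume ?B
      then obtain F where F: "strategy M F"
        "\<forall>s\<in>X. skolem_holds M F (rename_assignment T p s) (translate T e p (TConn c l r))" by (elim exE conjE)
      \<comment> \<open>The team is split according to which disjunct the fixed strategy makes true;
        the parts may overlap.\<close>
      let ?Y = "{s \<in> X. skolem_holds M F (rename_assignment T p s) ?l}"
      let ?Z = "{s \<in> X. skolem_holds M F (rename_assignment T p s) ?r}"
      have "X = ?Y \<union> ?Z" using F(2) Disj by auto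
      moreover have "\<exists>F. strategy M F \<and> (\<forall>s\<in>rename_assignment T p ` ?Y. skolem_holds M F s ?l)"
        "\<exists>F. strategy M F \<and> (\<forall>s\<in>rename_assignment T p ` ?Z. skolem_holds M F s ?r)"
        by (rule exI[of _ F]; use F(1) in auto)+
      ultimately show ?A by (intro exI[of _ ?Y] exI[of _ ?Z] conjI)
    qed
    finally show ?thesis .
  qed
next
  case (TQuant Q v V t)
  have label: "label_at T p = Some (LQuant Q v V)" using subtree_label[OF TQuant.prems(1)] by simp
  have v: "var_at T p = Some v" using label by (simp add: var_at_def)
  have sub: "subtree T (p @ [Fst]) t" using TQuant.prems(1) subtree_step by blast
  let ?g = "translate T e (p @ [Fst]) t"
  note ren = rename_assignment_quant[OF noreq v, of Fst]
  show ?case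
  proof (cases Q)
    case Forall
    have "(\<forall>s\<in>duplicate_team X (univ M) v. skolem_holds M F (rename_assignment T (p @ [Fst]) s) ?g) \<longleftrightarrow>
      (\<forall>s\<in>X. skolem_holds M F (rename_assignment T p s) (translate T e p (TQuant Q v V t)))" for F
      unfolding ball_duplicate_team ren Forall translate.simps skolem_holds.simps ..
    then show ?thesis
      using TQuant.IH[OF sub determined_duplicate[OF noreq TQuant.prems(2) label[unfolded Forall], of Fst "univ M"]]
      by (simp add: Forall)
  next
    case Exists
    let ?D = "\<lambda>s. rename_assignment T p s |` dep_vars T p"
    show ?thesis
    proof
      assume "team_sat M X (fill_gaps (TQuant Q v V t) (\<lambda>P. e (p @ P)))"
      then obtain f where f: "\<forall>s\<in>X. f s \<in> univ M" "uniform_on (fset V) X f"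
        "team_sat M (supplement_team X f v) (fill_gaps t (\<lambda>P. e ((p @ [Fst]) @ P)))"
        unfolding Exists by auto
      have dep: "f s = f s'" if "s \<in> X" "s' \<in> X" "?D s = ?D s'" for s s'
        using f(2) agreement_outside_slash_set[OF nonsig noreq TQuant.prems(2) label[unfolded Exists] that(1,2) _ that(3)]
          that(1,2) unfolding uniform_on_def by blast
      have det: "determined T (p @ [Fst]) (supplement_team X f v)"
        by (rule determined_supplement[OF noreq TQuant.prems(2) label[unfolded Exists] dep])
      obtain F where F: "strategy M F"
        "\<forall>s\<in>supplement_team X f v. skolem_holds M F (rename_assignment T (p @ [Fst]) s) ?g"
        using f(3) unfolding TQuant.IH[OF sub det] by (elim exE conjE)
      obtain a0 where a0: "a0 \<in> univ M" using univ by auto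
      \<comment> \<open>The Skolem function evaluates \<open>f\<close> at a representative of the
        team with the given arguments; by \<open>dep\<close> the representative does not matter.
        Arguments that do not occur in the team get \<open>a0\<close>.\<close>
      define h where "h d = (if \<exists>s\<in>X. ?D s = d then f (SOME s. s \<in> X \<and> ?D s = d) else a0)" for d
      have some: "(SOME s'. s' \<in> X \<and> ?D s' = ?D s) \<in> X \<and> ?D (SOME s'. s' \<in> X \<and> ?D s' = ?D s) = ?D s"
        if "s \<in> X" for s
        by (rule someI[of "\<lambda>s'. s' \<in> X \<and> ?D s' = ?D s" s]) (use that in simp)
      have h: "h (?D s) = f s" if "s \<in> X" for s
      proof -
        have "h (?D s) = f (SOME s'. s' \<in> X \<and> ?D s' = ?D s)" unfolding h_def using that by (intro if_P) blast
        also have "\<dots> = f s" using some[OF that] dep that by blast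
        finally show ?thesis .
      qed
      have h_univ: "h d \<in> univ M" for d
      proof (cases "\<exists>s\<in>X. ?D s = d")
        case True
        then show ?thesis using h f(1) by metis
      qed (use a0 in \<open>simp add: h_def\<close>)
      have "strategy M (F(code p := h))" using F(1) h_univ by (simp add: strategy_def)
      moreover have "skolem_holds M (F(code p := h)) (rename_assignment T p s) (translate T e p (TQuant Q v V t))"
        if s: "s \<in> X" for s
      proof -
        have "s(v \<mapsto> f s) \<in> supplement_team X f v" using s by (auto simp: supplement_team_def)
        then have "skolem_holds M F ((rename_assignment T p s)(code p \<mapsto> f s)) ?g" using F(2) ren by metis
        \<comment> \<open>The name \<open>code p\<close> is not bound below \<open>p\<close>, so the
          strategy may be redefined there.\<close>
        then have "skolem_holds M (F(code p := h)) ((rename_assignment T p s)(code p \<mapsto> f s)) ?g"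
          by (subst skolem_holds_cong_strategy[of _ _ F]) (use bnd_translate_below[of p T e Fst t] in auto)
        then show ?thesis by (simp only: Exists translate.simps skolem_holds.simps fun_upd_same h[OF s])
      qed
      ultimately show "\<exists>F. strategy M F \<and> (\<forall>s\<in>X. skolem_holds M F (rename_assignment T p s) (translate T e p (TQuant Q v V t)))"
        by blast
    next
      assume "\<exists>F. strategy M F \<and> (\<forall>s\<in>X. skolem_holds M F (rename_assignment T p s) (translate T e p (TQuant Q v V t)))"
      then obtain F where F: "strategy M F"
        "\<forall>s\<in>X. skolem_holds M F (rename_assignment T p s) (translate T e p (TQuant Q v V t))" by (elim exE conjE)
      define f where "f s = F (code p) (?D s)" for s
      have det: "determined T (p @ [Fst]) (supplement_team X f v)"
        by (rule determined_supplement[OF noreq TQuant.prems(2) label[unfolded Exists]]) (simp add: f_def)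
      have "skolem_holds M F (rename_assignment T (p @ [Fst]) s') ?g" if s': "s' \<in> supplement_team X f v" for s'
      proof -
        obtain s where s: "s \<in> X" "s' = s(v \<mapsto> f s)" using s' by (auto simp: supplement_team_def)
        then show ?thesis using F(2) by (simp add: ren Exists f_def del: fun_upd_apply)
      qed
      then have "team_sat M (supplement_team X f v) (fill_gaps t (\<lambda>P. e ((p @ [Fst]) @ P)))"
        unfolding TQuant.IH[OF sub det] using F(1) by blast
      moreover have "uniform_on (fset V) X f" unfolding f_def
        by (rule uniform_if_dependent[OF noreq label[unfolded Exists]])
      moreover have "\<forall>s\<in>X. f s \<in> univ M" using F(1) by (simp add: strategy_def f_def)
      ultimately show "team_sat M X (fill_gaps (TQuant Q v V t) (\<lambda>P. e (p @ P)))"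
        unfolding Exists by auto
    qed
  qed
qed

subsection \<open>Modest trees have good translations\<close>

text \<open>At the root the bound is empty, which makes the resulting first-order formula a
  sentence.\<close>

lemma free_translate:
  assumes "weak T e" and "sentential T e" and noreq: "tree_no_requantification T" and "subtree T p t"
  shows "free (translate T e p t) \<subseteq> code ` {q. strict_prefix q p \<and> var_at T q \<noteq> None}"
  using assms(4)
proof (induction t arbitrary: p)
  case Gap
  have "p \<in> paths T" using Gap unfolding subtree_def by force
  then have "quantifier_free (e p)" using assms(1) by (simp add: weak_def)
  moreover have "binder_var T p v \<in> code ` {q. strict_prefix q p \<and> var_at T q \<noteq> None}" if v: "v \<in> FV (e p)" for v
  proof -
    obtain q where q: "strict_prefix q p" "var_at T q = Some v" using gap_binders[OF assms(2) Gap v] by blast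
    then show ?thesis using rename_assignment_binder_var(1)[OF noreq q] by simp
  qed
  ultimately show ?case by (auto simp: fo_FV_rename)
next
  case (TConn c l r)
  have "var_at T p = None" using subtree_label[OF TConn.prems] by (simp add: var_at_def)
  then have "strict_prefix q (p @ [x]) \<and> var_at T q \<noteq> None \<longleftrightarrow> strict_prefix q p \<and> var_at T q \<noteq> None" for q x
    by (auto simp: strict_prefix_snoc strict_prefix_def)
  then show ?case
    using TConn.IH(1)[OF subtree_Fst_TConn[OF TConn.prems]] TConn.IH(2)[OF subtree_Snd_TConn[OF TConn.prems]]
    by simp
next
  case (TQuant Q v V t)
  have "strict_prefix q p" if "strict_prefix q (p @ [Fst])" "q \<noteq> p" for q
    using that by (auto simp: strict_prefix_snoc strict_prefix_def)
  moreover have "free (translate T e p (TQuant Q v V t)) = free (translate T e (p @ [Fst]) t) - {code p}"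
    by (cases Q) auto
  ultimately show ?case using TQuant.IH[OF subtree_TQuant[OF TQuant.prems]] by fastforce
qed

text \<open>Supplies the clause of \<open>apart\<close> by which an existential variable is never an
  argument below it.\<close>

lemma deps_translate: "deps (translate T e p t) \<subseteq> code ` {q. quant_at T Forall q}"
proof (induction t arbitrary: p)
  case (TQuant Q v V t)
  then show ?case by (cases Q) (auto simp: dep_vars_def)
qed auto

lemma dsyms_translate: "dsyms (translate T e p t) = syms (fill_gaps t (\<lambda>P. e (p @ P)))"
proof (induction t arbitrary: p)
  case (TQuant Q v V t)
  then show ?case by (cases Q) auto
qed (auto simp: fo_syms_rename)

text \<open>Comparability with \<open>p\<close> suffices to separate siblings: a position below one
  of them is neither above nor below the other.\<close>

lemma occ_translate:
  assumes "weak T e" and "sentential T e" and noreq: "tree_no_requantification T" and "subtree T p t"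
  shows "occ (translate T e p t) \<subseteq> code ` {q. prefix q p \<or> prefix p q}"
  using assms(4)
proof (induction t arbitrary: p)
  case Gap
  have "occ (translate T e p Gap) = free (translate T e p Gap)" by simp
  also have "\<dots> \<subseteq> code ` {q. strict_prefix q p \<and> var_at T q \<noteq> None}"
    by (rule free_translate[OF assms(1-3) Gap])
  also have "\<dots> \<subseteq> code ` {q. prefix q p \<or> prefix p q}"
    by (intro image_mono) (auto simp: strict_prefix_def)
  finally show ?case .
next
  case (TConn c l r)
  have "code ` {q. prefix q (p @ [x]) \<or> prefix (p @ [x]) q} \<subseteq> code ` {q. prefix q p \<or> prefix p q}" for x
    by (intro image_mono) (auto simp: prefix_snoc dest: append_prefixD)
  then show ?case unfolding translate.simps occ.simps
    using TConn.IH(1)[OF subtree_Fst_TConn[OF TConn.prems]] TConn.IH(2)[OF subtree_Snd_TConn[OF TConn.prems]]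
    by (meson Un_least subset_trans)
next
  case (TQuant Q v V t)
  have "code ` {q. prefix q (p @ [Fst]) \<or> prefix (p @ [Fst]) q} \<subseteq> code ` {q. prefix q p \<or> prefix p q}"
    by (intro image_mono) (auto simp: prefix_snoc dest: append_prefixD)
  then have "occ (translate T e (p @ [Fst]) t) \<subseteq> code ` {q. prefix q p \<or> prefix p q}"
    using TQuant.IH[OF subtree_TQuant[OF TQuant.prems]] by (rule subset_trans[rotated])
  moreover have "dep_vars T p \<subseteq> code ` {q. prefix q p \<or> prefix p q}"
    by (auto simp: dep_vars_def depends_def strict_prefix_def)
  moreover have "occ (translate T e p (TQuant Q v V t)) \<subseteq>
      insert (code p) (dep_vars T p \<union> occ (translate T e (p @ [Fst]) t))"
    by (cases Q) auto
  moreover have "code p \<in> code ` {q. prefix q p \<or> prefix p q}" by simp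
  ultimately show ?case by (meson Un_least insert_subset subset_trans)
qed

lemma apart_translate:
  assumes "weak T e" and "sentential T e" and noreq: "tree_no_requantification T" and "subtree T p t"
  shows "apart (translate T e p t)"
  using assms(4)
proof (induction t arbitrary: p)
  case (TConn c l r)
  have disjoint: "bnd (translate T e (p @ [x]) t) \<inter> occ (translate T e (p @ [y]) t') = {}"
    if "x \<noteq> y" "subtree T (p @ [y]) t'" for x y t t'
  proof -
    have "False" if "prefix (p @ [x]) q" "prefix q (p @ [y]) \<or> prefix (p @ [y]) q" for q
      using that \<open>x \<noteq> y\<close> by (auto simp: prefix_def append_eq_append_conv2 append_eq_Cons_conv)
    then show ?thesis
      using bnd_translate[of T e "p @ [x]" t] occ_translate[OF assms(1-3) that(2)] by fastforce
  qed
  then show ?case using TConn.IH subtree_Fst_TConn[OF TConn.prems] subtree_Snd_TConn[OF TConn.prems] by simp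
next
  case (TQuant Q v V t)
  have IH: "apart (translate T e (p @ [Fst]) t)" by (rule TQuant.IH[OF subtree_TQuant[OF TQuant.prems]])
  have below: "code p \<notin> bnd (translate T e (p @ [Fst]) t)" by (rule bnd_translate_below)
  show ?case
  proof (cases Q)
    case Forall
    then show ?thesis using IH below by simp
  next
    case Exists
    then have "\<not> quant_at T Forall p" using subtree_label[OF TQuant.prems] by (simp add: quant_at_def)
    then have "code p \<notin> deps (translate T e (p @ [Fst]) t)" using deps_translate[of T e "p @ [Fst]" t] by auto
    moreover have "dep_vars T p \<inter> bnd (translate T e (p @ [Fst]) t) = {}"
      using bnd_translate[of T e "p @ [Fst]" t] dep_vars_above[of _ T p]
      by (fastforce simp: dep_vars_def dest: prefix_length_less prefix_length_le)
    ultimately show ?thesis using Exists IH below by simp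
  qed
qed simp

section \<open>From pairs of scopes and dependency sets back to quantifier positions\<close>

definition univs :: "itree \<Rightarrow> pos \<Rightarrow> var set" where
  "univs T p = code ` {q. strict_prefix q p \<and> quant_at T Forall q}"

lemma univs_snoc: "univs T (p @ [x]) = (if quant_at T Forall p then insert (code p) (univs T p) else univs T p)"
  by (auto simp: univs_def strict_prefix_snoc strict_prefix_def)

lemma univs_snoc_label:
  "label_at T p = Some (LConn c) \<Longrightarrow> univs T (p @ [x]) = univs T p"
  "label_at T p = Some (LQuant Forall v V) \<Longrightarrow> univs T (p @ [x]) = insert (code p) (univs T p)"
  "label_at T p = Some (LQuant Exists v V) \<Longrightarrow> univs T (p @ [x]) = univs T p"
  by (auto simp: univs_snoc quant_at_def)

lemma exs_translate:
  assumes "subtree T p t" and "(U, A) \<in> exs (univs T p) (translate T e p t)"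
  shows "\<exists>q. prefix p q \<and> quant_at T Exists q \<and> U = univs T q \<and> A = dep_vars T q"
  using assms
proof (induction t arbitrary: p)
  case (TConn c l r)
  have label: "label_at T p = Some (LConn c)" using subtree_label[OF TConn.prems(1)] by simp
  from TConn.prems(2) consider "(U, A) \<in> exs (univs T (p @ [Fst])) (translate T e (p @ [Fst]) l)"
    | "(U, A) \<in> exs (univs T (p @ [Snd])) (translate T e (p @ [Snd]) r)"
    by (auto simp: univs_snoc_label(1)[OF label])
  then show ?case
  proof cases
    case 1
    show ?thesis using TConn.IH(1)[OF subtree_Fst_TConn[OF TConn.prems(1)] 1] append_prefixD by blast
  next
    case 2
    show ?thesis using TConn.IH(2)[OF subtree_Snd_TConn[OF TConn.prems(1)] 2] append_prefixD by blast
  qed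
next
  case (TQuant Q v V t)
  have label: "label_at T p = Some (LQuant Q v V)" using subtree_label[OF TQuant.prems(1)] by simp
  have "(U, A) \<in> exs (univs T (p @ [Fst])) (translate T e (p @ [Fst]) t) \<or>
      Q = Exists \<and> U = univs T p \<and> A = dep_vars T p"
    using TQuant.prems(2) label by (cases Q) (auto simp: univs_snoc_label)
  then show ?case
  proof
    assume "(U, A) \<in> exs (univs T (p @ [Fst])) (translate T e (p @ [Fst]) t)"
    from TQuant.IH[OF subtree_TQuant[OF TQuant.prems(1)] this] show ?thesis using append_prefixD by blast
  next
    assume "Q = Exists \<and> U = univs T p \<and> A = dep_vars T p"
    then show ?thesis using label by (intro exI[of _ p]) (simp add: quant_at_def)
  qed
qed simp

lemma code_in_univs: "code x \<in> univs T p \<longleftrightarrow> strict_prefix x p \<and> quant_at T Forall x"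
  by (auto simp: univs_def)

lemma code_in_dep_vars: "code x \<in> dep_vars T p \<longleftrightarrow> depends T p x \<and> quant_at T Forall x"
  by (auto simp: dep_vars_def)

text \<open>By contraposition, existentials with incomparable dependency sets are independent of
  each other. This yields the clauses on mutual independence in both forbidden patterns.\<close>

lemma dep_vars_subset_if_depends:
  assumes "\<not> signalling T" and "quant_at T Exists u" and "quant_at T Exists v" and "depends T u v"
  shows "dep_vars T v \<subseteq> dep_vars T u"
  using not_signallingD[OF assms(1) _ assms(3,2) _ assms(4)] by (auto simp: dep_vars_def)

lemma henkin_free_translate:
  assumes nonsig: "\<not> signalling T" and nonhenkin: "\<not> generalized_Henkin T"
  shows "henkin_free (exs {} (translate T e [] T))"
proof -
  have ex: "\<exists>q. quant_at T Exists q \<and> U = univs T q \<and> A = dep_vars T q"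
    if "(U, A) \<in> exs {} (translate T e [] T)" for U A
    using exs_translate[OF subtree_root, of U A] that by (auto simp: univs_def)
  show ?thesis unfolding henkin_free_def
  proof (intro conjI allI impI)
    fix U A assume "(U, A) \<in> exs {} (translate T e [] T)"
    from ex[OF this] show "A \<subseteq> U" by (auto simp: univs_def dep_vars_def depends_def)
  next
    fix U A U' A' n
    assume 1: "(U, A) \<in> exs {} (translate T e [] T)" and 2: "(U', A') \<in> exs {} (translate T e [] T)"
      and n: "n \<in> U \<inter> U'" "n \<in> A - A'"
    obtain u where u: "quant_at T Exists u" "U = univs T u" "A = dep_vars T u" using ex[OF 1] by blast
    obtain v where v: "quant_at T Exists v" "U' = univs T v" "A' = dep_vars T v" using ex[OF 2] by blast
    obtain x where x: "n = code x" using n(1) u(2) by (auto simp: univs_def)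
    show "A' \<subseteq> A"
    proof
      fix m assume m: "m \<in> A'"
      then obtain y where y: "m = code y" using v(3) by (auto simp: dep_vars_def)
      show "m \<in> A"
      proof (rule ccontr)
        assume "m \<notin> A"
        \<comment> \<open>The elements \<open>n\<close> and \<open>m\<close> witness that neither
          dependency set contains the other.\<close>
        have "\<not> depends T u v" "\<not> depends T v u"
          using dep_vars_subset_if_depends[OF nonsig] u v n m \<open>m \<notin> A\<close> by blast+
        then have "generalized_Henkin T" unfolding generalized_Henkin_def
          using u v n m \<open>m \<notin> A\<close> unfolding x y
          by (intro exI[of _ x] exI[of _ y] exI[of _ u] exI[of _ v]) (auto simp: code_in_univs code_in_dep_vars)
        then show False using nonhenkin by simp
      qed
    qed
  qed
qed

lemma coord_free_translate:
  assumes nonsig: "\<not> signalling T" and "\<not> coordinated T" and "subtree T p t"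
  shows "coord_free (univs T p) (translate T e p t)"
  using assms(3)
proof (induction t arbitrary: p)
  case (TConn c l r)
  have label: "label_at T p = Some (LConn c)" using subtree_label[OF TConn.prems(1)] by simp
  have "univs T p \<subseteq> A \<union> A' \<or> A \<subseteq> A' \<or> A' \<subseteq> A"
    if c: "c = Disj" and 1: "(U, A) \<in> exs (univs T p) (translate T e p (TConn c l r))"
      and 2: "(U', A') \<in> exs (univs T p) (translate T e p (TConn c l r))" for U A U' A'
  proof (rule ccontr)
    obtain u where u: "prefix p u" "quant_at T Exists u" "A = dep_vars T u"
      using exs_translate[OF TConn.prems 1] by blast
    obtain w where w: "prefix p w" "quant_at T Exists w" "A' = dep_vars T w"
      using exs_translate[OF TConn.prems 2] by blast
    have scope: "strict_prefix p u" "strict_prefix p w"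
      using u w label by (auto simp: strict_prefix_def quant_at_def)
    assume incomparable: "\<not> (univs T p \<subseteq> A \<union> A' \<or> A \<subseteq> A' \<or> A' \<subseteq> A)"
    then have "\<not> univs T p \<subseteq> A \<union> A'" "\<not> A \<subseteq> A'" "\<not> A' \<subseteq> A" by simp_all
    moreover have "A \<subseteq> range code" "A' \<subseteq> range code" "univs T p \<subseteq> range code"
      unfolding u(3) w(3) by (auto simp: dep_vars_def univs_def)
    \<comment> \<open>The three failures supply the universal quantifiers of a coordinated pattern
      around the disjunction at \<open>p\<close>: one above it that neither existential reads, and
      one private to each existential.\<close>
    ultimately obtain x y z where xyz: "code x \<in> univs T p - A - A'" "code y \<in> A - A'" "code z \<in> A' - A"
      by blast
    then have x: "quant_at T Forall x" "strict_prefix x p" "\<not> depends T u x" "\<not> depends T w x"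
      and y: "quant_at T Forall y" "depends T u y" "\<not> depends T w y"
      and z: "quant_at T Forall z" "depends T w z" "\<not> depends T u z"
      unfolding u(3) w(3) Diff_iff code_in_univs code_in_dep_vars by blast+
    have "\<not> depends T u w" "\<not> depends T w u"
      using dep_vars_subset_if_depends[OF nonsig u(2) w(2)] dep_vars_subset_if_depends[OF nonsig w(2) u(2)]
        xyz unfolding u(3) w(3) by blast+
    moreover have "conn_at T Disj p" using label c by (simp add: conn_at_def)
    ultimately have "coordinated T" unfolding coordinated_def
      using scope x y z u(2) w(2) by blast
    then show False using assms(2) by simp
  qed
  moreover have "coord_free (univs T p) (translate T e (p @ [Fst]) l)" "coord_free (univs T p) (translate T e (p @ [Snd]) r)"
    using TConn.IH(1)[OF subtree_Fst_TConn[OF TConn.prems]] TConn.IH(2)[OF subtree_Snd_TConn[OF TConn.prems]]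
    by (simp_all add: univs_snoc_label(1)[OF label])
  ultimately show ?case unfolding translate.simps coord_free.simps by (intro conjI impI allI)
next
  case (TQuant Q v V t)
  have "label_at T p = Some (LQuant Q v V)" using subtree_label[OF TQuant.prems(1)] by simp
  then show ?case using TQuant.IH[OF subtree_TQuant[OF TQuant.prems]]
    by (cases Q) (simp_all add: univs_snoc_label)
qed simp

theorem mainTheorem1:
  fixes T :: itree
  assumes "regular_tree T" and "modest T"
  shows "\<forall>e :: pos \<Rightarrow> ('f, 'r) ifml.
           completing T e \<and> weak T e \<and> sentential T e \<longrightarrow> finite_models_FO_definable (fill_gaps T e)"
proof (intro allI impI)
  fix e :: "pos \<Rightarrow> ('f, 'r) ifml"
  assume "completing T e \<and> weak T e \<and> sentential T e"
  then have e: "weak T e" "sentential T e" by simp_all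
  have noreq: "tree_no_requantification T" using assms(1) by (simp add: regular_tree_def)
  have nonsig: "\<not> signalling T" and nonhenkin: "\<not> generalized_Henkin T" and noncoord: "\<not> coordinated T"
    using assms(2) by (simp_all add: modest_def)
  let ?g = "translate T e [] T"
  have "coord_free {} ?g"
    using coord_free_translate[OF nonsig noncoord subtree_root, of e] by (simp add: univs_def)
  then have "good ?g" unfolding good_def
    using apart_translate[OF e noreq subtree_root] henkin_free_translate[OF nonsig nonhenkin] by blast
  then obtain \<theta> where \<theta>: "fo_defines TYPE(nat) \<theta> ?g" using good_fo_definable by blast
  have "fo_sentence \<theta>"
    using \<theta> free_translate[OF e noreq subtree_root] by (auto simp: fo_sentence_def fo_defines_def)
  moreover have "fo_syms \<theta> \<subseteq> syms (fill_gaps T e)"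
    using \<theta> dsyms_translate[of T e "[]" T] by (simp add: fo_defines_def)
  moreover have "if_true M (fill_gaps T e) \<longleftrightarrow> fo_true M \<theta>" if "finite_structure M" for M :: "(nat, 'f, 'r) struct"
  proof -
    have univ: "univ M \<noteq> {}" using that by (simp add: finite_structure_def)
    have "determined T [] {Map.empty :: nat assignment}" by (simp add: determined_def)
    from team_sat_iff_skolem[OF nonsig noreq e univ subtree_root this]
    have "if_true M (fill_gaps T e) \<longleftrightarrow> skolem_sat M Map.empty ?g"
      by (simp add: if_true_def skolem_sat_def rename_assignment_root)
    also have "\<dots> \<longleftrightarrow> fo_true M \<theta>" using \<theta> univ by (simp add: fo_defines_def fo_true_def)
    finally show ?thesis .
  qed
  then have "finite_models (fill_gaps T e) = fo_finite_models \<theta>"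
    by (auto simp: finite_models_def fo_finite_models_def)
  ultimately show "finite_models_FO_definable (fill_gaps T e)"
    unfolding finite_models_FO_definable_def by blast
qed

end
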